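(* Through the identification between the parameters $\mathbf m=(m_1,m_2,m_1',m_2',m_1'',m_2'')$ and roots of $E_6$ $$m_1=\alpha_3+\alpha_4+\alpha_5,\quad m_1'=\alpha_1+\alpha_2+\alpha_3,\quad m_1''=\alpha_3+\alpha_6,$$ $$m_2=\alpha_1+\alpha_2+\alpha_3+\alpha_4+\alpha_6,\quad m_2'=\alpha_2+\alpha_3+\alpha_4+\alpha_5+\alpha_6,\quad m_2''=\alpha_2+\alpha_3+\alpha_4,$$ the group of symmetries of the missing label (the group of transformations of the parameters $\mathbf m$ generated by the operations on the arrangement $\mathrm{Arr}(\mathbf m)$ described in the context) corresponds to the subgroup of $\pm W(E_6)$ generated by $$s_1,\ s_2,\ s_4,\ s_5,\ s_6\ \text{ and } -w_0 .$$ Moreover, for a transformation $g:\mathbf m\mapsto\tilde{\mathbf m}$ in this subgroup (where $\mathbf m$ are positive integers with $d_{\mathbf m}>0$), the pair of matrices $(X_{\mathbf m},Y_{\mathbf m})$ is simultaneously conjugated to $(\pm X_{\tilde{\mathbf m}},Y_{\tilde{\mathbf m}})$, the sign being $-1$ if and only if $g\in -W(E_6)$.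
   Context: Root system: $\alpha_1,\dots,\alpha_6$ are simple roots of type $E_6$ in Euclidean $\mathbb R^6$, $(\alpha_i,\alpha_i)=2$, with Dynkin diagram the chain $1-2-3-4-5$ together with the node $6$ attached to $3$ ($(\alpha_i,\alpha_j)=-1$ for adjacent nodes, $0$ otherwise). $W(E_6)$ is generated by the simple reflections $s_i(x)=x-(x,\alpha_i)\alpha_i$; $w_0$ is its longest element; $\pm W(E_6)$ is the group generated by $W(E_6)$ and $-\mathrm{Id}$, and $-W(E_6)=\{-w: w\in W(E_6)\}$. The six roots on the right of the identification form a basis of $\mathbb R^6$, so the linear action of $\pm W(E_6)$ on $\mathbb R^6$ gives a linear action on the parameters $\mathbf m$ (each parameter is replaced by the linear combination of parameters corresponding to the image of its root). Put $\ell=\frac13(m_1+2m_2+m_1'+2m_2'-m_1''-2m_2'')$, $n=\frac13(2m_1+m_2+2m_1'+m_2'-2m_1''-m_2'')$ and $$\mathrm{Arr}(\mathbf m)=\left[\begin{array}{ccc|ccc} m_1 & m'_1 & m''_2 & m_1+\ell-n & m'_1+\ell-n & m''_2+\ell-n\\ m'_1+m'_2-\ell & m_1+m_2-\ell & n & m'_1+m'_2-n & m_1+m_2-n & \ell\\ m_2+n-\ell & m'_2+n-\ell & m''_1+n-\ell & m_2 & m'_2 & m''_1 \end{array}\right].$$ The group of symmetries of the missing label is the group (of order 144) of transformations $\mathbf m\mapsto\tilde{\mathbf m}$ such that $\mathrm{Arr}(\tilde{\mathbf m})$ is obtained from $\mathrm{Arr}(\mathbf m)$ by compositions of: permutations of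 rows, permutations of columns, and matrix transposition, each performed simultaneously on the left and right $3\times3$ squares; and exchange of the left and right squares. $d_{\mathbf m}$ is the multiplicity of the $\mathfrak{su}_3$-irreducible $[m_1'',m_2'']$ in $[m_1,m_2]\otimes[m_1',m_2']$, where $[m_1,m_2]$ has highest weight with Dynkin labels $(m_1-1,m_2-1)$; it is non-zero if and only if all 18 entries of $\mathrm{Arr}(\mathbf m)$ are positive integers. The matrices $X_{\mathbf m},Y_{\mathbf m}$ (representing two generators of the centraliser of the diagonal $U(\mathfrak{su}_3)$ in $U(\mathfrak{su}_3)^{\otimes 2}$ on the multiplicity space) are as follows. $(\xi_1,\xi_2,\xi_3)=(\ell,m_2,m_1'+\ell-n)$ if $\ell\le n$ and $(n,m_1',m_2+n-\ell)$ if $n\le\ell$; $(\xi_4,\xi_5,\xi_6)=(\ell-m_2',n-m_1,0)$; $\Lambda=\sum_{i=1}^3\xi_i-\sum_{i=4}^6\xi_i+2|\ell-n|$; $\lambda_\pm=\pm\frac12\Lambda+\frac16\sum_{i=1}^6\xi_i$; $\xi_a=\min\{\xi_1,\xi_2,\xi_3\}$; $\xi_b=\max\{\xi_4,\xi_5,\xi_6\}$; $d=d_{\mathbf m}=\xi_a-\xi_b$. $X_{\mathbf m}=(a_{ij})$, $Y_{\mathbf m}=(b_{ij})$ are $d\times d$ tridiagonal with $a_{j,j+1}=\prod_{i=1}^3(j+\xi_b-\xi_i)$, $b_{j,j+1}=a_{j,j+1}(j+\xi_b-\lambda_-)$, $a_{j+1,j}=\prod_{i=4}^6(j+\xi_b-\xi_i)$,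 $b_{j+1,j}=a_{j+1,j}(j+\xi_b-\lambda_+)$, and, with $E_{j,k}=\sum_{i=1}^6(\xi_i-j-\xi_b+\frac12)^k$, $$a_{jj}=-\tfrac1{108}\bigl(\tfrac72E_{j,1}^3-18E_{j,1}E_{j,2}+18E_{j,3}\bigr)-\tfrac1{24}E_{j,1}(\Lambda^2+2),$$ $$b_{jj}=\tfrac1{288}\bigl(\tfrac52E_{j,1}^4+32E_{j,1}E_{j,3}+6(E_{j,2}^2-3E_{j,1}^2E_{j,2}-4E_{j,4})+6E_{j,2}(\Lambda^2+2)-3E_{j,1}^2(\Lambda^2-2)-\tfrac32\Lambda^4+6\Lambda^2-36\bigr).$$ *)

theory Defs
  imports
    "HOL-Analysis.Analysis"
    "HOL-Algebra.Bij"
    "HOL-Algebra.Generated_Groups"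
    "Jordan_Normal_Form.Matrix"
    "Jordan_Normal_Form.VS_Connect"
begin

no_notation vec_index (infixl "$" 100)

section \<open>The Weyl group of type $E_6$\<close>

text \<open>Nodes \<open>1-2-3-4-5\<close> form a chain and node \<open>6\<close> is attached to node \<open>3\<close>. Only the values
  of \<open>\<alpha>\<close> on \<open>{1..6}\<close> are relevant.\<close>

definition e6_adjacent :: "nat \<Rightarrow> nat \<Rightarrow> bool" where
  "e6_adjacent i j \<longleftrightarrow> {i, j} \<in> {{1, 2}, {2, 3}, {3, 4}, {4, 5}, {3, 6}}"

definition e6_simple_roots :: "(nat \<Rightarrow> real^6) \<Rightarrow> bool" where
  "e6_simple_roots \<alpha> \<longleftrightarrow>
     (\<forall>i\<in>{1..6}. \<forall>j\<in>{1..6}.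
        inner (\<alpha> i) (\<alpha> j) = (if i = j then 2 else if e6_adjacent i j then -1 else 0))"

definition simple_refl :: "(nat \<Rightarrow> real^6) \<Rightarrow> nat \<Rightarrow> real^6 \<Rightarrow> real^6" where
  "simple_refl \<alpha> i x = x - inner x (\<alpha> i) *\<^sub>R \<alpha> i"

text \<open>All transformation groups below are subgroups of \<open>BijGroup UNIV\<close>, whose product is
  composition of maps.\<close>

definition weyl_group :: "(nat \<Rightarrow> real^6) \<Rightarrow> (real^6 \<Rightarrow> real^6) set" where
  "weyl_group \<alpha> = generate (BijGroup UNIV) (simple_refl \<alpha> ` {1..6})"

definition pm_weyl_group :: "(nat \<Rightarrow> real^6) \<Rightarrow> (real^6 \<Rightarrow> real^6) set" where
  "pm_weyl_group \<alpha> = generate (BijGroup UNIV) (insert uminus (weyl_group \<alpha>))"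

definition neg_weyl :: "(nat \<Rightarrow> real^6) \<Rightarrow> (real^6 \<Rightarrow> real^6) set" where
  "neg_weyl \<alpha> = {\<lambda>x. - w x | w. w \<in> weyl_group \<alpha>}"

definition word_refl :: "(nat \<Rightarrow> real^6) \<Rightarrow> nat list \<Rightarrow> real^6 \<Rightarrow> real^6" where
  "word_refl \<alpha> is = foldr (\<lambda>i f. simple_refl \<alpha> i \<circ> f) is id"

definition weyl_length :: "(nat \<Rightarrow> real^6) \<Rightarrow> (real^6 \<Rightarrow> real^6) \<Rightarrow> nat" where
  "weyl_length \<alpha> w = (LEAST k. \<exists>is. length is = k \<and> set is \<subseteq> {1..6} \<and> w = word_refl \<alpha> is)"

definition longest_element :: "(nat \<Rightarrow> real^6) \<Rightarrow> real^6 \<Rightarrow> real^6" where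
  "longest_element \<alpha> =
     (THE w. w \<in> weyl_group \<alpha> \<and> (\<forall>v\<in>weyl_group \<alpha>. weyl_length \<alpha> v \<le> weyl_length \<alpha> w))"

definition missing_label_subgroup :: "(nat \<Rightarrow> real^6) \<Rightarrow> (real^6 \<Rightarrow> real^6) set" where
  "missing_label_subgroup \<alpha> =
     generate (BijGroup UNIV)
       (simple_refl \<alpha> ` {1, 2, 4, 5, 6} \<union> {\<lambda>x. - longest_element \<alpha> x})"


section \<open>Parameters and their identification with roots\<close>

datatype label = M1 | M2 | M1' | M2' | M1'' | M2''

lemma UNIV_label: "(UNIV :: label set) = {M1, M2, M1', M2', M1'', M2''}"
  using label.exhaust by blast

type_synonym params = "label \<Rightarrow> real"

fun param_root :: "(nat \<Rightarrow> real^6) \<Rightarrow> label \<Rightarrow> real^6" where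
  "param_root \<alpha> M1 = \<alpha> 3 + \<alpha> 4 + \<alpha> 5"
| "param_root \<alpha> M1' = \<alpha> 1 + \<alpha> 2 + \<alpha> 3"
| "param_root \<alpha> M1'' = \<alpha> 3 + \<alpha> 6"
| "param_root \<alpha> M2 = \<alpha> 1 + \<alpha> 2 + \<alpha> 3 + \<alpha> 4 + \<alpha> 6"
| "param_root \<alpha> M2' = \<alpha> 2 + \<alpha> 3 + \<alpha> 4 + \<alpha> 5 + \<alpha> 6"
| "param_root \<alpha> M2'' = \<alpha> 2 + \<alpha> 3 + \<alpha> 4"

text \<open>If \<open>g\<close> maps the root of the parameter \<open>k\<close> to \<open>\<Sum>l. c k l *\<^sub>R root l\<close>, then
  the parameter \<open>k\<close> is replaced by \<open>\<Sum>l. c k l * m l\<close>. On parameter values this reverses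
  composition: \<open>m\<close> is a linear functional on the root space, and \<open>g\<close> acts on it by
  precomposition.\<close>

definition param_action :: "(nat \<Rightarrow> real^6) \<Rightarrow> (real^6 \<Rightarrow> real^6) \<Rightarrow> params \<Rightarrow> params" where
  "param_action \<alpha> g m =
     (\<lambda>k. \<Sum>l\<in>UNIV. representation (range (param_root \<alpha>)) (g (param_root \<alpha> k)) (param_root \<alpha> l) * m l)"


section \<open>The arrangement and the symmetries of the missing label\<close>

definition par_l :: "params \<Rightarrow> real" where
  "par_l m = (m M1 + 2 * m M2 + m M1' + 2 * m M2' - m M1'' - 2 * m M2'') / 3"

definition par_n :: "params \<Rightarrow> real" where
  "par_n m = (2 * m M1 + m M2 + 2 * m M1' + m M2' - 2 * m M1'' - m M2'') / 3"

type_synonym squares = "(real^3^3) \<times> (real^3^3)"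

definition arr :: "params \<Rightarrow> squares" where
  "arr m = (let l = par_l m; n = par_n m in
     (vector [vector [m M1, m M1', m M2''],
              vector [m M1' + m M2' - l, m M1 + m M2 - l, n],
              vector [m M2 + n - l, m M2' + n - l, m M1'' + n - l]],
      vector [vector [m M1 + l - n, m M1' + l - n, m M2'' + l - n],
              vector [m M1' + m M2' - n, m M1 + m M2 - n, l],
              vector [m M2, m M2', m M1'']]))"

definition permute_rows :: "(3 \<Rightarrow> 3) \<Rightarrow> squares \<Rightarrow> squares" where
  "permute_rows p = map_prod (\<lambda>A. \<chi> i j. A $ p i $ j) (\<lambda>A. \<chi> i j. A $ p i $ j)"

definition permute_columns :: "(3 \<Rightarrow> 3) \<Rightarrow> squares \<Rightarrow> squares" where
  "permute_columns p = map_prod (\<lambda>A. \<chi> i j. A $ i $ p j) (\<lambda>A. \<chi> i j. A $ i $ p j)"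

definition square_operations :: "(squares \<Rightarrow> squares) set" where
  "square_operations = generate (BijGroup UNIV)
     ({permute_rows p | p. bij p} \<union> {permute_columns p | p. bij p} \<union>
      {map_prod transpose transpose, prod.swap})"

definition missing_label_symmetries :: "(params \<Rightarrow> params) set" where
  "missing_label_symmetries =
     {T. \<exists>\<sigma>\<in>square_operations. \<forall>m. arr (T m) = \<sigma> (arr m)}"


section \<open>Multiplicities in tensor products\<close>

text \<open>A complex representation of \<open>su\<^sub>3\<close> of dimension \<open>N\<close> is given by the matrices \<open>E i j\<close>
  (\<open>i, j \<in> {1..3}\<close>) representing the generators of the complexification
  \<open>sl\<^sub>3 \<cong> gl\<^sub>3 / center\<close>, i.e. the images of the matrix units, the identity acting by zero.\<close>

definition su3_rep :: "nat \<Rightarrow> (nat \<Rightarrow> nat \<Rightarrow> complex mat) \<Rightarrow> bool" where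
  "su3_rep N E \<longleftrightarrow>
     (\<forall>i\<in>{1..3}. \<forall>j\<in>{1..3}. E i j \<in> carrier_mat N N) \<and>
     (\<forall>i\<in>{1..3}. \<forall>j\<in>{1..3}. \<forall>k\<in>{1..3}. \<forall>l\<in>{1..3}.
        E i j * E k l - E k l * E i j =
          (if j = k then E i l else 0\<^sub>m N N) - (if l = i then E k j else 0\<^sub>m N N)) \<and>
     E 1 1 + E 2 2 + E 3 3 = 0\<^sub>m N N"

definition su3_irreducible :: "nat \<Rightarrow> (nat \<Rightarrow> nat \<Rightarrow> complex mat) \<Rightarrow> bool" where
  "su3_irreducible N E \<longleftrightarrow>
     su3_rep N E \<and> N > 0 \<and>
     (\<forall>U. subspace class_ring U (module_vec TYPE(complex) N) \<and>
          (\<forall>i\<in>{1..3}. \<forall>j\<in>{1..3}. \<forall>u\<in>U. E i j *\<^sub>v u \<in> U) \<longrightarrow>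
          U = {0\<^sub>v N} \<or> U = carrier_vec N)"

text \<open>\<open>su3_irrep a b\<close> describes \<open>[a, b]\<close>: its highest weight has Dynkin labels
  \<open>(a - 1, b - 1)\<close>.\<close>

definition su3_irrep :: "real \<Rightarrow> real \<Rightarrow> nat \<Rightarrow> (nat \<Rightarrow> nat \<Rightarrow> complex mat) \<Rightarrow> bool" where
  "su3_irrep a b N E \<longleftrightarrow>
     su3_irreducible N E \<and>
     (\<exists>v\<in>carrier_vec N. v \<noteq> 0\<^sub>v N \<and>
        (\<forall>i\<in>{1..3}. \<forall>j\<in>{1..3}. i < j \<longrightarrow> E i j *\<^sub>v v = 0\<^sub>v N) \<and>
        (E 1 1 - E 2 2) *\<^sub>v v = complex_of_real (a - 1) \<cdot>\<^sub>v v \<and>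
        (E 2 2 - E 3 3) *\<^sub>v v = complex_of_real (b - 1) \<cdot>\<^sub>v v)"

definition kronecker :: "'a::semiring_0 mat \<Rightarrow> 'a mat \<Rightarrow> 'a mat" where
  "kronecker A B = Matrix.mat (dim_row A * dim_row B) (dim_col A * dim_col B)
     (\<lambda>(i, j). A $$ (i div dim_row B, j div dim_col B) * B $$ (i mod dim_row B, j mod dim_col B))"

definition tensor_rep ::
  "nat \<Rightarrow> (nat \<Rightarrow> nat \<Rightarrow> complex mat) \<Rightarrow> nat \<Rightarrow> (nat \<Rightarrow> nat \<Rightarrow> complex mat) \<Rightarrow> nat \<Rightarrow> nat \<Rightarrow> complex mat" where
  "tensor_rep N E N' E' i j = kronecker (E i j) (1\<^sub>m N') + kronecker (1\<^sub>m N) (E' i j)"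

definition intertwiners ::
  "nat \<Rightarrow> (nat \<Rightarrow> nat \<Rightarrow> complex mat) \<Rightarrow> nat \<Rightarrow> (nat \<Rightarrow> nat \<Rightarrow> complex mat) \<Rightarrow> complex mat set" where
  "intertwiners N E K F =
     {T \<in> carrier_mat K N. \<forall>i\<in>{1..3}. \<forall>j\<in>{1..3}. T * E i j = F i j * T}"

text \<open>The multiplicity of an irreducible \<open>U\<close> in \<open>V\<close> is the dimension of the space of
  intertwiners from \<open>U\<close> to \<open>V\<close>. As irreducibles are determined by their highest weight up to
  isomorphism, it does not depend on the chosen matrices.\<close>

definition is_tensor_multiplicity :: "params \<Rightarrow> nat \<Rightarrow> bool" where
  "is_tensor_multiplicity m d \<longleftrightarrow>
     (\<exists>N E N' E' N'' E''.
        su3_irrep (m M1) (m M2) N E \<and>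
        su3_irrep (m M1') (m M2') N' E' \<and>
        su3_irrep (m M1'') (m M2'') N'' E'' \<and>
        d = vectorspace.dim class_ring
              ((module_mat TYPE(complex) (N * N') N'')
                \<lparr>carrier := intertwiners N'' E'' (N * N') (tensor_rep N E N' E')\<rparr>))"


section \<open>The matrices \<open>X\<close> and \<open>Y\<close>\<close>

definition xi :: "params \<Rightarrow> nat \<Rightarrow> real" where
  "xi m i = (let l = par_l m; n = par_n m in
     ((if l \<le> n then [l, m M2, m M1' + l - n] else [n, m M1', m M2 + n - l])
        @ [l - m M2', n - m M1, 0]) ! (i - 1))"

definition Lam :: "params \<Rightarrow> real" where
  "Lam m = (\<Sum>i=1..3. xi m i) - (\<Sum>i=4..6. xi m i) + 2 * \<bar>par_l m - par_n m\<bar>"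

definition lam_plus :: "params \<Rightarrow> real" where
  "lam_plus m = Lam m / 2 + (\<Sum>i=1..6. xi m i) / 6"

definition lam_minus :: "params \<Rightarrow> real" where
  "lam_minus m = - Lam m / 2 + (\<Sum>i=1..6. xi m i) / 6"

definition xi_a :: "params \<Rightarrow> real" where
  "xi_a m = Min (xi m ` {1..3})"

definition xi_b :: "params \<Rightarrow> real" where
  "xi_b m = Max (xi m ` {4..6})"

text \<open>For integral \<open>par_l m\<close> and \<open>par_n m\<close> (in particular for non-zero multiplicity)
  \<open>xi_a m - xi_b m\<close> is an integer; it then equals the multiplicity if positive.\<close>

definition mat_size :: "params \<Rightarrow> nat" where
  "mat_size m = nat \<lfloor>xi_a m - xi_b m\<rfloor>"

definition EE :: "params \<Rightarrow> nat \<Rightarrow> nat \<Rightarrow> real" where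
  "EE m j k = (\<Sum>i=1..6. (xi m i - real j - xi_b m + 1/2) ^ k)"

text \<open>The coefficients are named by their position relative to the diagonal:
  \<open>a_upper m j\<close> is the entry at \<open>(j, j+1)\<close>, \<open>a_lower m j\<close> the one at \<open>(j+1, j)\<close> and
  \<open>a_diag m j\<close> the one at \<open>(j, j)\<close>, with \<open>j\<close> starting at \<open>1\<close>.\<close>

definition a_upper :: "params \<Rightarrow> nat \<Rightarrow> real" where
  "a_upper m j = (\<Prod>i=1..3. real j + xi_b m - xi m i)"

definition a_lower :: "params \<Rightarrow> nat \<Rightarrow> real" where
  "a_lower m j = (\<Prod>i=4..6. real j + xi_b m - xi m i)"

definition a_diag :: "params \<Rightarrow> nat \<Rightarrow> real" where
  "a_diag m j =
     - (1/108) * (7/2 * EE m j 1 ^ 3 - 18 * EE m j 1 * EE m j 2 + 18 * EE m j 3)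
     - (1/24) * EE m j 1 * (Lam m ^ 2 + 2)"

definition b_upper :: "params \<Rightarrow> nat \<Rightarrow> real" where
  "b_upper m j = a_upper m j * (real j + xi_b m - lam_minus m)"

definition b_lower :: "params \<Rightarrow> nat \<Rightarrow> real" where
  "b_lower m j = a_lower m j * (real j + xi_b m - lam_plus m)"

definition b_diag :: "params \<Rightarrow> nat \<Rightarrow> real" where
  "b_diag m j =
     (1/288) * (5/2 * EE m j 1 ^ 4 + 32 * EE m j 1 * EE m j 3
       + 6 * (EE m j 2 ^ 2 - 3 * EE m j 1 ^ 2 * EE m j 2 - 4 * EE m j 4)
       + 6 * EE m j 2 * (Lam m ^ 2 + 2) - 3 * EE m j 1 ^ 2 * (Lam m ^ 2 - 2)
       - 3/2 * Lam m ^ 4 + 6 * Lam m ^ 2 - 36)"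

text \<open>Matrix entries are indexed from \<open>0\<close>, hence the shift.\<close>

definition tridiagonal ::
  "nat \<Rightarrow> (nat \<Rightarrow> real) \<Rightarrow> (nat \<Rightarrow> real) \<Rightarrow> (nat \<Rightarrow> real) \<Rightarrow> real mat" where
  "tridiagonal d up diag low = Matrix.mat d d (\<lambda>(i, j).
     if j = i + 1 then up (i + 1)
     else if i = j then diag (i + 1)
     else if i = j + 1 then low (j + 1)
     else 0)"

definition X_mat :: "params \<Rightarrow> real mat" where
  "X_mat m = tridiagonal (mat_size m) (a_upper m) (a_diag m) (a_lower m)"

definition Y_mat :: "params \<Rightarrow> real mat" where
  "Y_mat m = tridiagonal (mat_size m) (b_upper m) (b_diag m) (b_lower m)"

end

theory Submission
  imports Defs
begin

text \<open>A parameter vector is a linear functional on the root space evaluated at the six parameter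
  roots, and the group acts by precomposition. In terms of the values \<open>a\<^sub>i\<close> of the functional at
  the simple roots, \<open>\<ell>\<close> is the value at the sum of all simple roots and \<open>\<ell> - n = a\<^sub>6\<close>; the 18
  entries of the arrangement are the values at the positive roots containing \<open>\<alpha>\<^sub>3\<close> exactly once, the
  two squares being distinguished by the coefficient of \<open>\<alpha>\<^sub>6\<close>. The generators of both groups are
  then matched explicitly.

  The matrices \<open>X\<close> and \<open>Y\<close> depend only on \<open>\<bar>\<ell> - n\<bar>\<close> and, up to a common shift, on the multisets
  \<open>{\<xi>\<^sub>1, \<xi>\<^sub>2, \<xi>\<^sub>3} = c + {0, a\<^sub>4, a\<^sub>4 + a\<^sub>5}\<close> and \<open>{\<xi>\<^sub>4, \<xi>\<^sub>5, \<xi>\<^sub>6} = {0, a\<^sub>1, a\<^sub>1 + a\<^sub>2}\<close>, where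
  \<open>c = a\<^sub>1 + a\<^sub>2 + a\<^sub>3 + min a\<^sub>6 0\<close>. Hence the five reflections leave them unchanged, while \<open>-w\<^sub>0\<close>, the
  diagram automorphism, reflects and exchanges the two multisets, which amounts to conjugating
  \<open>(-X, Y)\<close> by the exchange matrix. The reflection needs \<open>\<xi>\<^sub>a - \<xi>\<^sub>b\<close> to be an integer; this is the
  triality condition: the weights of an irreducible representation form a single coset of the
  root lattice. The sign is well defined as \<open>-1\<close> is not in the Weyl group.\<close>

section \<open>Groups of bijections\<close>

lemma carrier_BijGroup_UNIV: "carrier (BijGroup UNIV) = {f. bij f}"
  by (auto simp: BijGroup_def Bij_def)

lemma one_BijGroup_UNIV: "\<one>\<^bsub>BijGroup UNIV\<^esub> = id"
  by (auto simp: BijGroup_def)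

lemma mult_BijGroup_UNIV:
  assumes "bij f" "bij g"
  shows "f \<otimes>\<^bsub>BijGroup UNIV\<^esub> g = f \<circ> g"
  using assms by (auto simp: BijGroup_def Bij_def compose_def)

lemma inv_BijGroup_UNIV:
  assumes "bij f"
  shows "m_inv (BijGroup UNIV) f = inv_into UNIV f"
proof (rule group.inv_equality[OF group_BijGroup])
  show "inv_into UNIV f \<otimes>\<^bsub>BijGroup UNIV\<^esub> f = \<one>\<^bsub>BijGroup UNIV\<^esub>"
    using assms by (simp add: mult_BijGroup_UNIV bij_imp_bij_inv one_BijGroup_UNIV bij_is_inj)
qed (use assms in \<open>auto simp: carrier_BijGroup_UNIV bij_imp_bij_inv\<close>)

lemma generate_BijGroup_bij:
  assumes "g \<in> generate (BijGroup UNIV) H" "\<And>h. h \<in> H \<Longrightarrow> bij h"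
  shows "bij g"
  using group.generate_in_carrier[OF group_BijGroup, of H UNIV g] assms
  by (auto simp: carrier_BijGroup_UNIV)

lemma generate_BijGroup_id: "id \<in> generate (BijGroup UNIV) H"
  using generate.one[of "BijGroup UNIV" H] by (simp add: one_BijGroup_UNIV)

lemma generate_BijGroup_comp:
  assumes "f \<in> generate (BijGroup UNIV) H" "g \<in> generate (BijGroup UNIV) H"
    and "\<And>h. h \<in> H \<Longrightarrow> bij h"
  shows "f \<circ> g \<in> generate (BijGroup UNIV) H"
  using generate.eng[OF assms(1,2)] generate_BijGroup_bij[OF assms(1)]
    generate_BijGroup_bij[OF assms(2)] assms(3)
  by (simp add: mult_BijGroup_UNIV)

text \<open>Restates induction over \<open>generate\<close> with composition and inverse functions
  in place of the abstract group product and inverse.\<close>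

lemma generate_BijGroup_induct [consumes 1, case_names bij id gen inv comp]:
  assumes "g \<in> generate (BijGroup UNIV) H" "\<And>h. h \<in> H \<Longrightarrow> bij h"
    and "P id" "\<And>h. h \<in> H \<Longrightarrow> P h" "\<And>h. h \<in> H \<Longrightarrow> P (inv_into UNIV h)"
    and "\<And>f g. f \<in> generate (BijGroup UNIV) H \<Longrightarrow> g \<in> generate (BijGroup UNIV) H \<Longrightarrow>
           P f \<Longrightarrow> P g \<Longrightarrow> P (f \<circ> g)"
  shows "P g"
  using assms(1)
proof induction
  case (eng h1 h2)
  then have "bij h1" "bij h2"
    using generate_BijGroup_bij assms(2) by blast+
  with eng show ?case
    using assms(6)[of h1 h2] by (metis mult_BijGroup_UNIV)
next
  case one
  show ?case unfolding one_BijGroup_UNIV by (rule assms(3))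
qed (use assms(2,4,5) in \<open>auto simp: inv_BijGroup_UNIV\<close>)

lemma inv_into_involution: "(\<And>x. f (f x) = x) \<Longrightarrow> inv_into UNIV f = f"
  by (metis comp_apply eq_id_iff inv_unique_comp)

lemma bij_involution: "(\<And>x. f (f x) = x) \<Longrightarrow> bij f"
  by (metis bijI')

section \<open>The root system\<close>

type_synonym coords = "int \<times> int \<times> int \<times> int \<times> int \<times> int"

text \<open>Coordinates are taken with respect to the simple roots. A simple reflection changes only
  its own coordinate, to the sum of the neighbouring ones minus itself. Integer tuples make the
  finite checks on roots executable.\<close>

fun refl_coords :: "nat \<Rightarrow> coords \<Rightarrow> coords" where
  "refl_coords i (a, b, c, d, e, f) =
     (if i = 1 then (b - a, b, c, d, e, f)
      else if i = 2 then (a, a + c - b, c, d, e, f)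
      else if i = 3 then (a, b, b + d + f - c, d, e, f)
      else if i = 4 then (a, b, c, c + e - d, e, f)
      else if i = 5 then (a, b, c, d, d - e, f)
      else (a, b, c, d, e, c - f))"

definition unit_coords :: "nat \<Rightarrow> coords" where
  "unit_coords i = (of_bool (i = 1), of_bool (i = 2), of_bool (i = 3), of_bool (i = 4),
     of_bool (i = 5), of_bool (i = 6))"

fun flip_coords :: "coords \<Rightarrow> coords" where
  "flip_coords (a, b, c, d, e, f) = (e, d, c, b, a, f)"

fun neg_coords :: "coords \<Rightarrow> coords" where
  "neg_coords (a, b, c, d, e, f) = (-a, -b, -c, -d, -e, -f)"

fun height_coords :: "coords \<Rightarrow> int" where
  "height_coords (a, b, c, d, e, f) = a + b + c + d + e + f"

text \<open>The 36 positive roots of type \<open>E_6\<close>, ordered by height; the last one is the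
  highest root.\<close>

definition pos_coords :: "coords list" where
  "pos_coords = [(0, 0, 0, 0, 0, 1), (0, 0, 0, 0, 1, 0), (0, 0, 0, 1, 0, 0), (0, 0, 1, 0, 0, 0),
     (0, 1, 0, 0, 0, 0), (1, 0, 0, 0, 0, 0), (0, 0, 0, 1, 1, 0), (0, 0, 1, 0, 0, 1),
     (0, 0, 1, 1, 0, 0), (0, 1, 1, 0, 0, 0), (1, 1, 0, 0, 0, 0), (0, 0, 1, 1, 0, 1),
     (0, 0, 1, 1, 1, 0), (0, 1, 1, 0, 0, 1), (0, 1, 1, 1, 0, 0), (1, 1, 1, 0, 0, 0),
     (0, 0, 1, 1, 1, 1), (0, 1, 1, 1, 0, 1), (0, 1, 1, 1, 1, 0), (1, 1, 1, 0, 0, 1),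
     (1, 1, 1, 1, 0, 0), (0, 1, 1, 1, 1, 1), (0, 1, 2, 1, 0, 1), (1, 1, 1, 1, 0, 1),
     (1, 1, 1, 1, 1, 0), (0, 1, 2, 1, 1, 1), (1, 1, 1, 1, 1, 1), (1, 1, 2, 1, 0, 1),
     (0, 1, 2, 2, 1, 1), (1, 1, 2, 1, 1, 1), (1, 2, 2, 1, 0, 1), (1, 1, 2, 2, 1, 1),
     (1, 2, 2, 1, 1, 1), (1, 2, 2, 2, 1, 1), (1, 2, 3, 2, 1, 1), (1, 2, 3, 2, 1, 2)]"

definition flip :: "nat \<Rightarrow> nat" where
  "flip i = (if i \<in> {1..5} then 6 - i else i)"

text \<open>The sixth power of a bipartite Coxeter element; the Coxeter number is 12.\<close>

definition longest_word :: "nat list" where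
  "longest_word = concat (replicate 6 [1, 3, 5, 2, 4, 6])"

text \<open>A simple reflection permutes the positive roots other than its own root. With the roots
  listed this is a finite check; \<open>set [1..<7]\<close> replaces the interval to allow
  evaluation.\<close>

lemma refl_coords_pos:
  assumes "i \<in> {1..6}" "c \<in> set pos_coords" "c \<noteq> unit_coords i"
  shows "refl_coords i c \<in> set pos_coords"
proof -
  have "\<forall>i\<in>set [1..<7]. \<forall>c\<in>set pos_coords. c = unit_coords i \<or> refl_coords i c \<in> set pos_coords"
    by code_simp
  then show ?thesis using assms by force
qed

lemma unit_coords_pos: "i \<in> {1..6} \<Longrightarrow> unit_coords i \<in> set pos_coords"
proof -
  have "\<forall>i\<in>set [1..<7]. unit_coords i \<in> set pos_coords"
    by code_simp
  then show "i \<in> {1..6} \<Longrightarrow> ?thesis" by force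
qed

lemma flip_coords_pos: "c \<in> set pos_coords \<Longrightarrow> flip_coords c \<in> set pos_coords"
proof -
  have "\<forall>c\<in>set pos_coords. flip_coords c \<in> set pos_coords"
    by code_simp
  then show "c \<in> set pos_coords \<Longrightarrow> ?thesis" by blast
qed

lemma height_coords_pos: "c \<in> set pos_coords \<Longrightarrow> height_coords c > 0"
proof -
  have "\<forall>c\<in>set pos_coords. height_coords c > 0"
    by code_simp
  then show "c \<in> set pos_coords \<Longrightarrow> ?thesis" by blast
qed

text \<open>By linearity the values at the simple roots determine the word: it acts as minus the
  diagram automorphism.\<close>

lemma longest_word_unit_coords:
  "i \<in> {1..6} \<Longrightarrow>
     foldr refl_coords longest_word (unit_coords i) = neg_coords (unit_coords (flip i))"
proof -
  have "\<forall>i\<in>set [1..<7].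
    foldr refl_coords longest_word (unit_coords i) = neg_coords (unit_coords (flip i))"
    by code_simp
  then show "i \<in> {1..6} \<Longrightarrow> ?thesis" by force
qed

lemma flip_in: "i \<in> {1..6} \<Longrightarrow> flip i \<in> {1..6}"
  by (auto simp: flip_def)

declare One_nat_def [simp del]

section \<open>The simple roots as a basis of the Euclidean space\<close>

locale e6 =
  fixes \<alpha> :: "nat \<Rightarrow> real^6"
  assumes simple_roots: "e6_simple_roots \<alpha>"
begin

lemma inner_simple_roots:
  "i \<in> {1..6} \<Longrightarrow> j \<in> {1..6} \<Longrightarrow>
     inner (\<alpha> i) (\<alpha> j) = (if i = j then 2 else if e6_adjacent i j then -1 else 0)"
  using simple_roots by (auto simp: e6_simple_roots_def)

lemma e6_adjacent_iff:
  "e6_adjacent i j \<longleftrightarrow> (i, j) \<in> {(1, 2), (2, 1), (2, 3), (3, 2), (3, 4), (4, 3), (4, 5), (5, 4), (3, 6), (6, 3)}"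
  by (auto simp: e6_adjacent_def doubleton_eq_iff)

lemma nodes: "{1..6::nat} = {1, 2, 3, 4, 5, 6}"
  by auto

text \<open>Pairing a vanishing combination with each simple root gives a linear system whose matrix
  is the nonsingular Cartan matrix.\<close>

lemma independent_simple_roots:
  assumes "(\<Sum>i\<in>{1..6}. c i *\<^sub>R \<alpha> i) = 0" "j \<in> {1..6}"
  shows "c j = 0"
proof -
  have *: "(\<Sum>i\<in>{1..6}. c i * inner (\<alpha> i) (\<alpha> k)) = 0" for k
    using arg_cong[OF assms(1), of "\<lambda>x. inner x (\<alpha> k)"] by (simp add: inner_sum_left)
  have "2 * c 1 - c 2 = 0" "2 * c 2 - c 1 - c 3 = 0" "2 * c 3 - c 2 - c 4 - c 6 = 0"
    "2 * c 4 - c 3 - c 5 = 0" "2 * c 5 - c 4 = 0" "2 * c 6 - c 3 = 0"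
    using *[of 1] *[of 2] *[of 3] *[of 4] *[of 5] *[of 6]
    by (simp_all add: nodes inner_simple_roots e6_adjacent_iff)
  then have "c 1 = 0 \<and> c 2 = 0 \<and> c 3 = 0 \<and> c 4 = 0 \<and> c 5 = 0 \<and> c 6 = 0"
    by linarith
  then show ?thesis
    using assms(2) by (auto simp: nodes)
qed

lemma inj_on_simple_roots: "inj_on \<alpha> {1..6}"
proof (rule inj_onI, rule ccontr)
  fix i j assume "i \<in> {1..6}" "j \<in> {1..6}" "\<alpha> i = \<alpha> j" "i \<noteq> j"
  then show False
    using inner_simple_roots[of i i] inner_simple_roots[of j i] by (auto split: if_splits)
qed

lemma independent_simple_roots_set: "independent (\<alpha> ` {1..6})"
proof (rule independent_if_scalars_zero)
  fix f x assume f: "(\<Sum>x\<in>\<alpha> ` {1..6}. f x *\<^sub>R x) = 0" and x: "x \<in> \<alpha> ` {1..6}"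
  from f have "(\<Sum>i\<in>{1..6}. f (\<alpha> i) *\<^sub>R \<alpha> i) = 0"
    by (simp add: sum.reindex[OF inj_on_simple_roots])
  from x obtain i where "i \<in> {1..6}" "x = \<alpha> i" by blast
  with independent_simple_roots[OF \<open>(\<Sum>i\<in>{1..6}. f (\<alpha> i) *\<^sub>R \<alpha> i) = 0\<close>] show "f x = 0" by blast
qed simp

lemma span_simple_roots: "span (\<alpha> ` {1..6}) = UNIV"
  using card_ge_dim_independent[OF subset_UNIV independent_simple_roots_set]
  by (auto simp: card_image[OF inj_on_simple_roots])

lemma linear_eq_on_simple_roots:
  assumes "linear f" "linear g" "\<And>i. i \<in> {1..6} \<Longrightarrow> f (\<alpha> i) = g (\<alpha> i)"
  shows "f = g"
proof
  fix x
  show "f x = g x"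
    by (rule linear_eq_on[OF assms(1,2), of x "\<alpha> ` {1..6}"])
       (use assms(3) span_simple_roots in auto)
qed

lemma ex_linear_simple_roots:
  fixes v :: "nat \<Rightarrow> 'b::real_vector"
  shows "\<exists>f. linear f \<and> (\<forall>i\<in>{1..6}. f (\<alpha> i) = v i)"
proof -
  obtain f where "linear f" "\<forall>x\<in>\<alpha> ` {1..6}. f x = v (inv_into {1..6} \<alpha> x)"
    using linear_independent_extend[OF independent_simple_roots_set, of "\<lambda>x. v (inv_into {1..6} \<alpha> x)"]
    by (elim exE conjE)
  then show ?thesis using inv_into_f_f[OF inj_on_simple_roots] by (metis imageI)
qed

section \<open>Simple reflections and words in them\<close>

lemma linear_simple_refl: "linear (simple_refl \<alpha> i)"
  by (rule linearI) (auto simp: simple_refl_def algebra_simps inner_left_distrib)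

lemma simple_refl_simple_root: "i \<in> {1..6} \<Longrightarrow> simple_refl \<alpha> i (\<alpha> i) = - \<alpha> i"
  by (simp add: simple_refl_def inner_simple_roots scaleR_2)

lemma simple_refl_invol: "i \<in> {1..6} \<Longrightarrow> simple_refl \<alpha> i (simple_refl \<alpha> i x) = x"
  by (simp add: simple_refl_def inner_diff_left inner_simple_roots algebra_simps)

lemma bij_simple_refl: "i \<in> {1..6} \<Longrightarrow> bij (simple_refl \<alpha> i)"
  by (rule bij_involution) (rule simple_refl_invol)

lemma inner_simple_refl:
  "i \<in> {1..6} \<Longrightarrow> inner (simple_refl \<alpha> i x) (simple_refl \<alpha> i y) = inner x y"
  by (simp add: simple_refl_def inner_diff_left inner_diff_right inner_simple_roots algebra_simps
      inner_commute)

lemma word_refl_Nil [simp]: "word_refl \<alpha> [] = id"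
  and word_refl_Cons [simp]: "word_refl \<alpha> (i # is) = simple_refl \<alpha> i \<circ> word_refl \<alpha> is"
  by (auto simp: word_refl_def)

lemma word_refl_append: "word_refl \<alpha> (is @ js) = word_refl \<alpha> is \<circ> word_refl \<alpha> js"
  by (induction "is") (auto simp: fun_eq_iff)

lemma linear_word_refl: "linear (word_refl \<alpha> is)"
proof (induction "is")
  case Nil
  show ?case unfolding word_refl_Nil by (rule linear_id)
next
  case (Cons i "is")
  then show ?case unfolding word_refl_Cons by (rule linear_compose[OF _ linear_simple_refl])
qed

lemma inner_word_refl:
  "set is \<subseteq> {1..6} \<Longrightarrow> inner (word_refl \<alpha> is x) (word_refl \<alpha> is y) = inner x y"
  by (induction "is") (auto simp: inner_simple_refl)

text \<open>Simple reflections are involutions, so words without inverses exhaust the generated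
  group. This links the group to the words through which the length is defined.\<close>

lemma weyl_group_iff:
  "w \<in> weyl_group \<alpha> \<longleftrightarrow> (\<exists>is. set is \<subseteq> {1..6} \<and> w = word_refl \<alpha> is)"
proof
  assume "w \<in> weyl_group \<alpha>"
  then have "w \<in> generate (BijGroup UNIV) (simple_refl \<alpha> ` {1..6})"
    by (simp add: weyl_group_def)
  then show "\<exists>is. set is \<subseteq> {1..6} \<and> w = word_refl \<alpha> is"
  proof (induction rule: generate_BijGroup_induct)
    case id
    then show ?case by (intro exI[of _ "[]"]) auto
  next
    case (gen h)
    then obtain i where "i \<in> {1..6}" "h = simple_refl \<alpha> i" by auto
    then show ?case by (intro exI[of _ "[i]"]) auto
  next
    case (inv h)
    then obtain i where "i \<in> {1..6}" "h = simple_refl \<alpha> i" by auto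
    then show ?case
      by (intro exI[of _ "[i]"]) (auto simp: inv_into_involution simple_refl_invol)
  next
    case (comp f g)
    then obtain js ks where "set js \<subseteq> {1..6}" "f = word_refl \<alpha> js"
      and "set ks \<subseteq> {1..6}" "g = word_refl \<alpha> ks" by blast
    then show ?case by (intro exI[of _ "js @ ks"]) (simp add: word_refl_append)
  qed (auto simp: bij_simple_refl)
next
  have "set is \<subseteq> {1..6} \<Longrightarrow> word_refl \<alpha> is \<in> generate (BijGroup UNIV) (simple_refl \<alpha> ` {1..6})" for "is"
  proof (induction "is")
    case (Cons i "is")
    then show ?case
      unfolding word_refl_Cons
      by (intro generate_BijGroup_comp) (auto intro: generate.incl bij_simple_refl)
  qed (simp add: generate_BijGroup_id)
  then show "\<exists>is. set is \<subseteq> {1..6} \<and> w = word_refl \<alpha> is \<Longrightarrow> w \<in> weyl_group \<alpha>"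
    by (auto simp: weyl_group_def)
qed

section \<open>Positive roots, the exchange condition, and length as a number of inversions\<close>

fun root_vec :: "coords \<Rightarrow> real^6" where
  "root_vec (a, b, c, d, e, f) = of_int a *\<^sub>R \<alpha> 1 + of_int b *\<^sub>R \<alpha> 2 + of_int c *\<^sub>R \<alpha> 3
     + of_int d *\<^sub>R \<alpha> 4 + of_int e *\<^sub>R \<alpha> 5 + of_int f *\<^sub>R \<alpha> 6"

lemma root_vec_unit: "i \<in> {1..6} \<Longrightarrow> root_vec (unit_coords i) = \<alpha> i"
  by (auto simp: nodes unit_coords_def)

lemma root_vec_neg: "root_vec (neg_coords c) = - root_vec c"
  by (cases c) simp

text \<open>On \<open>real^'n\<close> the numeral 2 is also a constant vector and the product is
  componentwise. These rules turn such a product under a scaling into a scalar factor.\<close>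

lemma scaleR_two_times:
  fixes v :: "real^'n"
  shows "a *\<^sub>R (2 * v) = (a * 2) *\<^sub>R v" "a *\<^sub>R (v * 2) = (a * 2) *\<^sub>R v"
  by (simp_all add: Finite_Cartesian_Product.vec_eq_iff)

lemma simple_refl_root_vec:
  "i \<in> {1..6} \<Longrightarrow> simple_refl \<alpha> i (root_vec c) = root_vec (refl_coords i c)"
  by (cases c)
     (auto simp: nodes simple_refl_def inner_left_distrib inner_simple_roots e6_adjacent_iff scaleR_two_times algebra_simps)

lemma word_refl_root_vec:
  "set is \<subseteq> {1..6} \<Longrightarrow> word_refl \<alpha> is (root_vec c) = root_vec (foldr refl_coords is c)"
  by (induction "is") (auto simp: simple_refl_root_vec)

definition pos_roots :: "(real^6) set" where
  "pos_roots = root_vec ` set pos_coords"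

abbreviation neg_roots :: "(real^6) set" where
  "neg_roots \<equiv> uminus ` pos_roots"

lemma finite_pos_roots: "finite pos_roots"
  by (simp add: pos_roots_def)

lemma simple_root_pos: "i \<in> {1..6} \<Longrightarrow> \<alpha> i \<in> pos_roots"
  using unit_coords_pos[of i] root_vec_unit[of i] by (auto simp: pos_roots_def intro!: image_eqI[of _ _ "unit_coords i"])

lemma pos_neg_disjoint:
  assumes "\<beta> \<in> pos_roots"
  shows "\<beta> \<notin> neg_roots"
proof
  assume "\<beta> \<in> neg_roots"
  then obtain \<gamma> where \<gamma>: "\<gamma> \<in> pos_roots" "\<beta> = - \<gamma>" by blast
  \<comment> \<open>The height functional: it is positive on positive roots, which separates them
    from the negative ones.\<close>
  obtain f :: "real^6 \<Rightarrow> real" where f: "linear f" "\<And>i. i \<in> {1..6} \<Longrightarrow> f (\<alpha> i) = 1"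
    using ex_linear_simple_roots[of "\<lambda>_. 1::real"] by blast
  have "f (root_vec c) = height_coords c" for c
    by (cases c) (simp add: linear_add[OF f(1)] linear_scale[OF f(1)] f(2))
  then have pos: "f \<gamma> > 0" if "\<gamma> \<in> pos_roots" for \<gamma>
    using that height_coords_pos
    by (auto simp: pos_roots_def simp del: root_vec.simps height_coords.simps)
  show False
    using pos[OF assms] pos[OF \<gamma>(1)] \<gamma>(2) by (simp add: linear_neg[OF f(1)])
qed

lemma simple_refl_pos:
  assumes "i \<in> {1..6}" "\<beta> \<in> pos_roots" "\<beta> \<noteq> \<alpha> i"
  shows "simple_refl \<alpha> i \<beta> \<in> pos_roots"
proof -
  obtain c where "c \<in> set pos_coords" "\<beta> = root_vec c"
    using assms by (auto simp: pos_roots_def)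
  moreover from this have "c \<noteq> unit_coords i" using assms root_vec_unit by auto
  ultimately show ?thesis
    using assms(1) refl_coords_pos simple_refl_root_vec by (auto simp: pos_roots_def)
qed

lemma simple_refl_roots:
  assumes "i \<in> {1..6}" "\<beta> \<in> pos_roots \<union> neg_roots"
  shows "simple_refl \<alpha> i \<beta> \<in> pos_roots \<union> neg_roots"
proof -
  have *: "simple_refl \<alpha> i \<gamma> \<in> pos_roots \<union> neg_roots" if "\<gamma> \<in> pos_roots" for \<gamma>
    using simple_refl_pos[OF assms(1) that] simple_refl_simple_root[OF assms(1)]
      simple_root_pos[OF assms(1)] by (cases "\<gamma> = \<alpha> i") auto
  show ?thesis
    using assms(2)
  proof
    assume "\<beta> \<in> neg_roots"
    then obtain \<gamma> where "\<gamma> \<in> pos_roots" "\<beta> = - \<gamma>" by auto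
    then show ?thesis using *[of \<gamma>] by (force simp: linear_neg[OF linear_simple_refl])
  qed (rule *)
qed

lemma word_refl_roots:
  "set is \<subseteq> {1..6} \<Longrightarrow> \<beta> \<in> pos_roots \<union> neg_roots \<Longrightarrow> word_refl \<alpha> is \<beta> \<in> pos_roots \<union> neg_roots"
proof (induction "is")
  case (Cons i "is")
  then show ?case
    using simple_refl_roots[of i "word_refl \<alpha> is \<beta>"] by (simp del: Un_iff)
qed simp

text \<open>Induction on the first letter \<open>k\<close>. If the remaining word already makes
  \<open>\<alpha> i\<close> negative, the letter is kept and a later one is deleted. Otherwise
  \<open>k\<close> itself causes the change of sign and is the letter to delete.\<close>

lemma exchange:
  assumes "set is \<subseteq> {1..6}" "i \<in> {1..6}" "word_refl \<alpha> is (\<alpha> i) \<in> neg_roots"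
  shows "\<exists>js. set js \<subseteq> {1..6} \<and> Suc (length js) = length is \<and>
           word_refl \<alpha> js = word_refl \<alpha> is \<circ> simple_refl \<alpha> i"
  using assms
proof (induction "is")
  case Nil
  then show ?case using pos_neg_disjoint simple_root_pos by auto
next
  case (Cons k "is")
  let ?w = "word_refl \<alpha> is"
  have k: "k \<in> {1..6}" and sub: "set is \<subseteq> {1..6}" using Cons.prems by auto
  show ?case
  proof (cases "?w (\<alpha> i) \<in> neg_roots")
    case True
    from Cons.IH[OF sub Cons.prems(2) True] obtain js where
      "set js \<subseteq> {1..6}" "Suc (length js) = length is" "word_refl \<alpha> js = ?w \<circ> simple_refl \<alpha> i"
      by blast
    with k show ?thesis by (intro exI[of _ "k # js"]) (auto simp: comp_assoc)
  next
    case False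
    then have "?w (\<alpha> i) \<in> pos_roots"
      using word_refl_roots[OF sub, of "\<alpha> i"] simple_root_pos[OF Cons.prems(2)] by auto
    moreover have "simple_refl \<alpha> k (?w (\<alpha> i)) \<in> neg_roots" using Cons.prems(3) by simp
    \<comment> \<open>The only positive root that the reflection of node \<open>k\<close> makes
      negative is \<open>\<alpha> k\<close>.\<close>
    ultimately have eq: "?w (\<alpha> i) = \<alpha> k"
      using simple_refl_pos[OF k] pos_neg_disjoint by blast
    \<comment> \<open>The isometry \<open>?w\<close> conjugates the reflection in
      \<open>\<alpha> i\<close> into the reflection in its image \<open>\<alpha> k\<close>.\<close>
    have "?w (simple_refl \<alpha> i x) = simple_refl \<alpha> k (?w x)" for x
      using inner_word_refl[OF sub, of x "\<alpha> i"]
      by (simp add: simple_refl_def linear_diff[OF linear_word_refl] linear_scale[OF linear_word_refl] eq)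
    then have "word_refl \<alpha> (k # is) \<circ> simple_refl \<alpha> i = ?w"
      by (simp add: fun_eq_iff simple_refl_invol[OF k])
    then show ?thesis using sub by (metis length_Cons)
  qed
qed

definition inversions :: "(real^6 \<Rightarrow> real^6) \<Rightarrow> (real^6) set" where
  "inversions w = {\<beta> \<in> pos_roots. w \<beta> \<in> neg_roots}"

text \<open>Since \<open>simple_refl \<alpha> i\<close> permutes the positive roots other than
  \<open>\<alpha> i\<close>, it carries the inversions of \<open>w\<close> to those of the product,
  and \<open>\<alpha> i\<close> is the one new inversion.\<close>

lemma card_inversions_comp_simple_refl:
  assumes "linear w" "i \<in> {1..6}" "w (\<alpha> i) \<in> pos_roots"
  shows "card (inversions (w \<circ> simple_refl \<alpha> i)) = Suc (card (inversions w))"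
proof -
  let ?s = "simple_refl \<alpha> i"
  have 1: "\<alpha> i \<notin> ?s ` inversions w"
  proof
    assume "\<alpha> i \<in> ?s ` inversions w"
    then obtain \<gamma> where \<gamma>: "\<gamma> \<in> pos_roots" "\<alpha> i = ?s \<gamma>" by (auto simp: inversions_def)
    then have "\<gamma> = - \<alpha> i"
      using simple_refl_invol[OF assms(2), of \<gamma>] simple_refl_simple_root[OF assms(2)] by simp
    with \<gamma>(1) simple_root_pos[OF assms(2)] show False using pos_neg_disjoint by blast
  qed
  have 2: "inversions (w \<circ> ?s) = insert (\<alpha> i) (?s ` inversions w)"
  proof (intro Set.set_eqI iffI)
    fix \<beta> assume \<beta>: "\<beta> \<in> inversions (w \<circ> ?s)"
    show "\<beta> \<in> insert (\<alpha> i) (?s ` inversions w)"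
    proof (cases "\<beta> = \<alpha> i")
      case False
      then have "?s \<beta> \<in> inversions w"
        using \<beta> simple_refl_pos[OF assms(2)] by (auto simp: inversions_def)
      then show ?thesis using simple_refl_invol[OF assms(2), of \<beta>] by (metis insertI2 image_eqI)
    qed simp
  next
    fix \<beta> assume "\<beta> \<in> insert (\<alpha> i) (?s ` inversions w)"
    then consider "\<beta> = \<alpha> i" | \<gamma> where "\<gamma> \<in> pos_roots" "w \<gamma> \<in> neg_roots" "\<beta> = ?s \<gamma>"
      by (auto simp: inversions_def)
    then show "\<beta> \<in> inversions (w \<circ> ?s)"
    proof cases
      case 1
      then show ?thesis
        using assms simple_root_pos
        by (auto simp: inversions_def simple_refl_simple_root linear_neg[OF assms(1)])
    next
      case 2
      then have "\<gamma> \<noteq> \<alpha> i" using assms(3) pos_neg_disjoint by blast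
      with 2 show ?thesis
        using simple_refl_pos[OF assms(2)] simple_refl_invol[OF assms(2)] by (auto simp: inversions_def)
    qed
  qed
  have "inj ?s" using bij_simple_refl[OF assms(2)] bij_is_inj by blast
  then have "card (?s ` inversions w) = card (inversions w)"
    by (meson card_image inj_on_subset subset_UNIV)
  then show ?thesis
    using 1 2 finite_pos_roots by (simp add: inversions_def)
qed

lemma ex_reduced_word:
  assumes "w \<in> weyl_group \<alpha>"
  obtains "is" where "set is \<subseteq> {1..6}" "w = word_refl \<alpha> is" "length is = weyl_length \<alpha> w"
proof -
  have "\<exists>k is. length is = k \<and> set is \<subseteq> {1..6} \<and> w = word_refl \<alpha> is"
    using assms weyl_group_iff by auto
  from LeastI_ex[OF this] show ?thesis using that unfolding weyl_length_def by metis
qed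

lemma weyl_length_le: "set is \<subseteq> {1..6} \<Longrightarrow> weyl_length \<alpha> (word_refl \<alpha> is) \<le> length is"
  unfolding weyl_length_def by (rule Least_le) auto

text \<open>A prefix of a reduced word is reduced, and it sends the root of the next letter to a
  positive root, as the exchange condition would otherwise shorten the word. Hence every letter adds
  exactly one inversion.\<close>

lemma card_inversions_reduced_word:
  assumes "set is \<subseteq> {1..6}" "length is = weyl_length \<alpha> (word_refl \<alpha> is)"
  shows "card (inversions (word_refl \<alpha> is)) = length is"
  using assms
proof (induction "is" rule: rev_induct)
  case Nil
  have "inversions id = {}" using pos_neg_disjoint by (auto simp: inversions_def)
  then show ?case by (simp only: word_refl_Nil list.size card.empty)
next
  case (snoc i "is")
  let ?w = "word_refl \<alpha> is"
  have i: "i \<in> {1..6}" and sub: "set is \<subseteq> {1..6}" using snoc.prems by auto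
  have w: "word_refl \<alpha> (is @ [i]) = ?w \<circ> simple_refl \<alpha> i"
    by (simp add: word_refl_append)
  have red: "length is = weyl_length \<alpha> ?w"
  proof (rule antisym)
    have "?w \<in> weyl_group \<alpha>" using sub weyl_group_iff by blast
    then obtain js where js: "set js \<subseteq> {1..6}" "?w = word_refl \<alpha> js" "length js = weyl_length \<alpha> ?w"
      by (rule ex_reduced_word)
    have "word_refl \<alpha> (is @ [i]) = word_refl \<alpha> (js @ [i])"
      using js(2) by (simp add: word_refl_append)
    then show "length is \<le> weyl_length \<alpha> ?w"
      using weyl_length_le[of "js @ [i]"] js i snoc.prems(2) by auto
  qed (rule weyl_length_le[OF sub])
  have "?w (\<alpha> i) \<notin> neg_roots"
  proof
    assume "?w (\<alpha> i) \<in> neg_roots"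
    from exchange[OF sub i this] obtain js where
      "set js \<subseteq> {1..6}" "Suc (length js) = length is" "word_refl \<alpha> js = word_refl \<alpha> (is @ [i])"
      using w by auto
    then show False using weyl_length_le[of js] snoc.prems(2) by auto
  qed
  then have "?w (\<alpha> i) \<in> pos_roots"
    using word_refl_roots[OF sub, of "\<alpha> i"] simple_root_pos[OF i] by auto
  from card_inversions_comp_simple_refl[OF linear_word_refl i this] snoc.IH[OF sub red]
  show ?case unfolding w by (metis length_append_singleton)
qed

lemma weyl_length_eq_card_inversions:
  assumes "w \<in> weyl_group \<alpha>"
  shows "weyl_length \<alpha> w = card (inversions w)"
  using ex_reduced_word[OF assms] card_inversions_reduced_word by metis

section \<open>The longest element and its action\<close>

lemma longest_word_nodes: "set longest_word \<subseteq> {1..6}"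
  by (auto simp: longest_word_def)

lemma longest_word_simple_root:
  assumes "i \<in> {1..6}"
  shows "word_refl \<alpha> longest_word (\<alpha> i) = - \<alpha> (flip i)"
  using word_refl_root_vec[OF longest_word_nodes, of "unit_coords i"] longest_word_unit_coords[OF assms]
  by (simp only: root_vec_neg root_vec_unit[OF assms] root_vec_unit[OF flip_in[OF assms]])

lemma longest_word_root_vec: "word_refl \<alpha> longest_word (root_vec c) = - root_vec (flip_coords c)"
proof -
  have "word_refl \<alpha> longest_word (\<alpha> 1) = - \<alpha> 5" "word_refl \<alpha> longest_word (\<alpha> 2) = - \<alpha> 4"
    "word_refl \<alpha> longest_word (\<alpha> 3) = - \<alpha> 3" "word_refl \<alpha> longest_word (\<alpha> 4) = - \<alpha> 2"
    "word_refl \<alpha> longest_word (\<alpha> 5) = - \<alpha> 1" "word_refl \<alpha> longest_word (\<alpha> 6) = - \<alpha> 6"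
    by (simp_all add: longest_word_simple_root flip_def One_nat_def)
  then show ?thesis
    by (cases c) (simp add: linear_add[OF linear_word_refl] linear_scale[OF linear_word_refl])
qed

lemma longest_word_invol: "word_refl \<alpha> longest_word \<circ> word_refl \<alpha> longest_word = id"
  by (rule linear_eq_on_simple_roots)
     (auto intro!: linear_compose linear_word_refl linear_id
        simp: longest_word_simple_root linear_neg[OF linear_word_refl] flip_in[simplified] flip_def)

text \<open>The length counts inversions, so it is at most the number of positive roots, and the
  word attains this bound. Uniqueness is needed as well, because the longest element is defined by a
  definite description.\<close>

lemma longest_element_eq: "longest_element \<alpha> = word_refl \<alpha> longest_word"
proof -
  let ?w = "word_refl \<alpha> longest_word"
  have w: "?w \<in> weyl_group \<alpha>" using longest_word_nodes weyl_group_iff by blast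
  have neg: "?w \<beta> \<in> neg_roots" if "\<beta> \<in> pos_roots" for \<beta>
  proof -
    from that obtain c where "c \<in> set pos_coords" "\<beta> = root_vec c"
      by (auto simp: pos_roots_def simp del: root_vec.simps)
    then show ?thesis
      using flip_coords_pos longest_word_root_vec by (auto simp: pos_roots_def simp del: root_vec.simps)
  qed
  have "inversions ?w = pos_roots" using neg by (auto simp: inversions_def)
  then have len: "weyl_length \<alpha> ?w = card pos_roots"
    using weyl_length_eq_card_inversions[OF w] by simp
  have le: "weyl_length \<alpha> v \<le> card pos_roots" if "v \<in> weyl_group \<alpha>" for v
    using weyl_length_eq_card_inversions[OF that] finite_pos_roots
    by (auto simp: inversions_def intro!: card_mono)
  show ?thesis
    unfolding longest_element_def
  proof (rule the_equality)
    show "?w \<in> weyl_group \<alpha> \<and> (\<forall>v\<in>weyl_group \<alpha>. weyl_length \<alpha> v \<le> weyl_length \<alpha> ?w)"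
      using w le len by simp
  next
    fix v assume v: "v \<in> weyl_group \<alpha> \<and> (\<forall>u\<in>weyl_group \<alpha>. weyl_length \<alpha> u \<le> weyl_length \<alpha> v)"
    then have "card (inversions v) = card pos_roots"
      using le[of v] w len weyl_length_eq_card_inversions[of v] by (metis antisym)
    then have all: "inversions v = pos_roots"
      using finite_pos_roots by (intro card_subset_eq) (auto simp: inversions_def)
    \<comment> \<open>Both factors exchange positive and negative roots. The product therefore has
      no inversions, has length 0 and is the identity.\<close>
    have "inversions (?w \<circ> v) = {}"
    proof -
      have "?w (v \<beta>) \<in> pos_roots" if "\<beta> \<in> pos_roots" for \<beta>
      proof -
        from that all have "v \<beta> \<in> neg_roots" by (auto simp: inversions_def)
        then show ?thesis using neg by (force simp: linear_neg[OF linear_word_refl])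
      qed
      then show ?thesis using pos_neg_disjoint by (auto simp: inversions_def)
    qed
    moreover have wv: "?w \<circ> v \<in> weyl_group \<alpha>"
      using w v unfolding weyl_group_def by (intro generate_BijGroup_comp) (auto simp: bij_simple_refl)
    ultimately have "weyl_length \<alpha> (?w \<circ> v) = 0"
      using weyl_length_eq_card_inversions by simp
    with ex_reduced_word[OF wv] have "?w \<circ> v = id" by (metis length_0_conv word_refl_Nil)
    then show "v = ?w" using longest_word_invol by (metis comp_assoc comp_id id_comp)
  qed
qed

text \<open>The Weyl group acts trivially on the quotient of the weight lattice by the root lattice,
  which is cyclic of order 3, whereas \<open>-1\<close> acts on it by inversion.\<close>

lemma weyl_group_neg_weyl_disjoint: "w \<in> weyl_group \<alpha> \<Longrightarrow> w \<notin> neg_weyl \<alpha>"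
proof -
  \<comment> \<open>A weight outside the root lattice: its inner products with the simple roots are
    0, 0, 1, -1, 0, 1 in some order, hence integral, while its coefficient 1/3 at
    \<open>\<alpha> 1\<close> is not an integer.\<close>
  define wt where "wt = (1/3) *\<^sub>R \<alpha> 1 + (2/3) *\<^sub>R \<alpha> 2 + (1/3) *\<^sub>R \<alpha> 4 + (2/3) *\<^sub>R \<alpha> 5"
  have ex: "\<exists>c. word_refl \<alpha> is wt = wt + root_vec c" if "set is \<subseteq> {1..6}" for "is"
    using that
  proof (induction "is")
    case Nil
    show ?case by (rule exI[of _ "(0,0,0,0,0,0)"]) simp
  next
    case (Cons i "is")
    have i: "i \<in> {1..6}" using Cons.prems by simp
    from Cons obtain c where c: "word_refl \<alpha> is wt = wt + root_vec c" by auto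
    have "\<exists>d. simple_refl \<alpha> i wt = wt + root_vec d"
    proof -
      have "inner wt (\<alpha> i) \<in> \<int>"
        using i by (auto simp: wt_def nodes inner_left_distrib inner_simple_roots e6_adjacent_iff)
      then obtain k where "inner wt (\<alpha> i) = of_int k" by (auto elim: Ints_cases)
      then have "simple_refl \<alpha> i wt = wt + root_vec (let k = -k in
        (k * of_bool (i=1), k * of_bool (i=2), k * of_bool (i=3), k * of_bool (i=4),
         k * of_bool (i=5), k * of_bool (i=6)))"
        using i by (auto simp: simple_refl_def nodes)
      then show ?thesis by blast
    qed
    then obtain d where d: "simple_refl \<alpha> i wt = wt + root_vec d" ..
    have add: "root_vec x + root_vec y \<in> range root_vec" for x y
    proof -
      obtain a b c d e f where x: "x = (a,b,c,d,e,f)" by (cases x)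
      obtain a' b' c' d' e' f' where y: "y = (a',b',c',d',e',f')" by (cases y)
      show ?thesis
        by (rule range_eqI[of _ _ "(a+a', b+b', c+c', d+d', e+e', f+f')"])
           (simp add: x y algebra_simps)
    qed
    have "word_refl \<alpha> (i # is) wt = wt + (root_vec d + root_vec (refl_coords i c))"
      using c d simple_refl_root_vec[OF i, of c]
      by (simp add: linear_add[OF linear_simple_refl] del: refl_coords.simps)
    with add[of d "refl_coords i c"] show ?case by (metis rangeE)
  qed
  show "w \<in> weyl_group \<alpha> \<Longrightarrow> w \<notin> neg_weyl \<alpha>"
  proof
    assume "w \<in> weyl_group \<alpha>" "w \<in> neg_weyl \<alpha>"
    then obtain "is" js where "set is \<subseteq> {1..6}" "set js \<subseteq> {1..6}"
      and "w = word_refl \<alpha> is" "w = (\<lambda>x. - word_refl \<alpha> js x)"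
      by (auto simp: neg_weyl_def weyl_group_iff)
    with ex[of "is"] ex[of js] obtain c d where
      eq: "wt + root_vec c = - (wt + root_vec d)" by metis
    obtain f :: "real^6 \<Rightarrow> real"
      where f: "linear f" "\<And>i. i \<in> {1..6} \<Longrightarrow> f (\<alpha> i) = of_bool (i = 1)"
      using ex_linear_simple_roots[of "\<lambda>i. of_bool (i = 1)"] by blast
    from eq have "f (wt + root_vec c) = f (- (wt + root_vec d))"
      by (intro arg_cong[OF eq])
    moreover have "f (root_vec c) = of_int (fst c)" for c
      by (cases c) (simp add: linear_add[OF f(1)] linear_scale[OF f(1)] f(2))
    moreover have "f wt = 1/3"
      by (simp add: wt_def linear_add[OF f(1)] linear_scale[OF f(1)] f(2))
    \<comment> \<open>Comparison of the coefficients of \<open>\<alpha> 1\<close>, which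
      \<open>f\<close> extracts.\<close>
    ultimately have "2/3 = (of_int (- fst c - fst d) :: real)"
      by (simp add: linear_add[OF f(1)] linear_neg[OF f(1)] linear_diff[OF f(1)])
    then have "of_int 2 = (of_int (3 * (- fst c - fst d)) :: real)" by simp
    then have "2 = 3 * (- fst c - fst d)" using of_int_eq_iff by blast
    then show False by presburger
  qed
qed

end

section \<open>The action on parameters\<close>

definition perm3 :: "3 \<Rightarrow> 3 \<Rightarrow> 3 \<Rightarrow> 3 \<Rightarrow> 3" where
  "perm3 x y z i = (if i = 1 then x else if i = 2 then y else z)"

lemma perm3_simps [simp]: "perm3 x y z 1 = x" "perm3 x y z 2 = y" "perm3 x y z 3 = z"
  by (auto simp: perm3_def)

lemma bij_perm3: "distinct [x, y, z] \<Longrightarrow> bij (perm3 x y z)"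
proof -
  assume *: "distinct [x, y, z]"
  have "inj (perm3 x y z)"
  proof (rule injI)
    fix i j assume "perm3 x y z i = perm3 x y z j"
    then show "i = j" using * exhaust_3[of i] exhaust_3[of j] by auto
  qed
  then show ?thesis by (simp add: bij_def finite_UNIV_inj_surj)
qed

lemma bij_3_cases:
  assumes "bij (p :: 3 \<Rightarrow> 3)"
  shows "p \<in> {perm3 1 2 3, perm3 1 3 2, perm3 2 1 3, perm3 2 3 1, perm3 3 1 2, perm3 3 2 1}"
proof -
  have "p = perm3 (p 1) (p 2) (p 3)"
    by (simp add: fun_eq_iff forall_3)
  moreover have "p 1 \<noteq> p 2" "p 1 \<noteq> p 3" "p 2 \<noteq> p 3"
    using bij_is_inj[OF assms] by (simp_all add: inj_eq)
  ultimately show ?thesis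
    using exhaust_3[of "p 1"] exhaust_3[of "p 2"] exhaust_3[of "p 3"] by auto
qed

text \<open>\<open>mk_params a b c d e f\<close> is the parameter vector of the functional with these values at the
  simple roots \<open>1, ..., 6\<close>.\<close>

definition mk_params :: "real \<Rightarrow> real \<Rightarrow> real \<Rightarrow> real \<Rightarrow> real \<Rightarrow> real \<Rightarrow> params" where
  "mk_params a b c d e f k = (case k of M1 \<Rightarrow> c + d + e | M1' \<Rightarrow> a + b + c | M1'' \<Rightarrow> c + f
     | M2 \<Rightarrow> a + b + c + d + f | M2' \<Rightarrow> b + c + d + e + f | M2'' \<Rightarrow> b + c + d)"

lemma mk_params_simps [simp]:
  "mk_params a b c d e f M1 = c + d + e" "mk_params a b c d e f M1' = a + b + c"
  "mk_params a b c d e f M1'' = c + f" "mk_params a b c d e f M2 = a + b + c + d + f"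
  "mk_params a b c d e f M2' = b + c + d + e + f" "mk_params a b c d e f M2'' = b + c + d"
  by (simp_all add: mk_params_def)

lemma par_l_mk_params [simp]: "par_l (mk_params a b c d e f) = a + b + c + d + e + f"
  by (simp add: par_l_def)

lemma par_n_mk_params [simp]: "par_n (mk_params a b c d e f) = a + b + c + d + e"
  by (simp add: par_n_def)

lemma mk_params_exhaust: obtains a b c d e f where "m = mk_params a b c d e f"
proof -
  \<comment> \<open>Read as values of the functional, \<open>l\<close> belongs to the sum of all
    simple roots and \<open>f\<close> to \<open>\<alpha> 6\<close>. The roots of \<open>M2'\<close>
    and \<open>M2\<close> are that sum without \<open>\<alpha> 1\<close> and without
    \<open>\<alpha> 5\<close>, which gives \<open>a\<close> and \<open>e\<close>.\<close>
  define l where "l = par_l m"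
  define f where "f = l - par_n m"
  define c where "c = m M1'' - f"
  define a where "a = l - m M2'"
  define e where "e = l - m M2"
  have "m k = mk_params a (m M1' - a - c) c (m M1 - c - e) e f k" for k
    by (cases k) (simp_all add: f_def c_def a_def e_def l_def par_l_def par_n_def field_simps)
  then show ?thesis using that by blast
qed

text \<open>Each left entry is \<open>c\<close> plus one of \<open>0, b, a + b\<close> plus one of
  \<open>0, d, d + e\<close>; the right square adds \<open>f\<close> throughout. The two choices
  form a pair of orthogonal Latin squares, so every row and every column contains each summand
  once.\<close>

lemma arr_mk_params:
  "arr (mk_params a b c d e f) =
     (vector [vector [c + d + e, a + b + c, b + c + d],
              vector [b + c, c + d, a + b + c + d + e],
              vector [a + b + c + d, b + c + d + e, c]],
      vector [vector [c + d + e + f, a + b + c + f, b + c + d + f],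
              vector [b + c + f, c + d + f, a + b + c + d + e + f],
              vector [a + b + c + d + f, b + c + d + e + f, c + f]])"
  by (simp add: arr_def Let_def add.commute add.left_commute)

text \<open>Makes a transformation of parameters recoverable from its effect on the
  arrangement.\<close>

lemma inj_arr: "inj arr"
proof (rule injI)
  fix m m' assume eq: "arr m = arr m'"
  have "m M1 = fst (arr m) $ 1 $ 1 \<and> m M1' = fst (arr m) $ 1 $ 2 \<and> m M2'' = fst (arr m) $ 1 $ 3 \<and>
    m M2 = snd (arr m) $ 3 $ 1 \<and> m M2' = snd (arr m) $ 3 $ 2 \<and> m M1'' = snd (arr m) $ 3 $ 3" for m
    by (simp add: arr_def Let_def)
  with eq have "m k = m' k" for k
    by (cases k) metis+
  then show "m = m'" by blast
qed

section \<open>The generators of the subgroup and their words\<close>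

context e6
begin

abbreviation dual_flip :: "real^6 \<Rightarrow> real^6" where
  "dual_flip \<equiv> \<lambda>x. - longest_element \<alpha> x"

lemma linear_dual_flip: "linear dual_flip"
  unfolding longest_element_eq by (intro linear_compose_neg linear_word_refl)

lemma dual_flip_simple_root: "i \<in> {1..6} \<Longrightarrow> dual_flip (\<alpha> i) = \<alpha> (flip i)"
  by (simp only: longest_element_eq longest_word_simple_root minus_minus)

lemma dual_flip_invol: "dual_flip (dual_flip x) = x"
  using fun_cong[OF longest_word_invol, of x]
  by (simp add: longest_element_eq linear_neg[OF linear_word_refl])

text \<open>The index 0, which is not a node, stands for the generator \<open>-w_0\<close>. All six
  generators can then be handled by words of numbers.\<close>

definition ml_gen :: "nat \<Rightarrow> real^6 \<Rightarrow> real^6" where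
  "ml_gen i = (if i = 0 then dual_flip else simple_refl \<alpha> i)"

lemma missing_label_subgroup_eq:
  "missing_label_subgroup \<alpha> = generate (BijGroup UNIV) (ml_gen ` {0, 1, 2, 4, 5, 6})"
proof -
  have "simple_refl \<alpha> ` {1, 2, 4, 5, 6} \<union> {\<lambda>x. - longest_element \<alpha> x} = ml_gen ` {0, 1, 2, 4, 5, 6}"
    by (simp add: ml_gen_def) blast
  then show ?thesis by (simp only: missing_label_subgroup_def)
qed

lemma linear_ml_gen: "linear (ml_gen i)"
  using linear_dual_flip linear_simple_refl by (simp add: ml_gen_def)

lemma ml_gen_invol: "i \<in> {0, 1, 2, 4, 5, 6} \<Longrightarrow> ml_gen i (ml_gen i x) = x"
  using dual_flip_invol simple_refl_invol[of i] unfolding ml_gen_def by auto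

lemma bij_ml_gen: "i \<in> {0, 1, 2, 4, 5, 6} \<Longrightarrow> bij (ml_gen i)"
  by (rule bij_involution) (rule ml_gen_invol)

lemma missing_label_subgroup_induct [consumes 1, case_names id gen comp]:
  assumes "g \<in> missing_label_subgroup \<alpha>" "P id" "\<And>i. i \<in> {0, 1, 2, 4, 5, 6} \<Longrightarrow> P (ml_gen i)"
    and "\<And>g h. g \<in> missing_label_subgroup \<alpha> \<Longrightarrow> h \<in> missing_label_subgroup \<alpha> \<Longrightarrow> P g \<Longrightarrow> P h \<Longrightarrow> P (g \<circ> h)"
  shows "P g"
  using assms(1) unfolding missing_label_subgroup_eq
proof (induction rule: generate_BijGroup_induct)
  case id
  show ?case by (rule assms(2))
next
  case (bij h)
  then show ?case using bij_ml_gen by blast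
next
  case (gen h)
  then show ?case using assms(3) by blast
next
  case (inv h)
  then obtain i where i: "i \<in> {0, 1, 2, 4, 5, 6}" "h = ml_gen i" by blast
  then have "inv_into UNIV h = h" using inv_into_involution[of h] ml_gen_invol by blast
  then show ?case using i assms(3) by simp
next
  case (comp g h)
  then show ?case using assms(4) unfolding missing_label_subgroup_eq by blast
qed

lemma linear_missing_label_subgroup: "g \<in> missing_label_subgroup \<alpha> \<Longrightarrow> linear g"
proof (induction rule: missing_label_subgroup_induct)
  case id
  show ?case by (rule linear_id)
next
  case (gen i)
  show ?case by (rule linear_ml_gen)
next
  case (comp g h)
  then show ?case by (intro linear_compose)
qed

lemma id_in_missing_label_subgroup: "id \<in> missing_label_subgroup \<alpha>"
  by (simp add: missing_label_subgroup_def generate_BijGroup_id)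

lemma ml_gen_in: "i \<in> {0, 1, 2, 4, 5, 6} \<Longrightarrow> ml_gen i \<in> missing_label_subgroup \<alpha>"
  unfolding missing_label_subgroup_eq by (intro generate.incl imageI)

lemma comp_in_missing_label_subgroup:
  "g \<in> missing_label_subgroup \<alpha> \<Longrightarrow> h \<in> missing_label_subgroup \<alpha> \<Longrightarrow> g \<circ> h \<in> missing_label_subgroup \<alpha>"
  unfolding missing_label_subgroup_eq using bij_ml_gen by (intro generate_BijGroup_comp) auto

section \<open>The parameter roots as a basis, and the action as precomposition of
  functionals\<close>

lemma finite_range_param_root: "finite (range (param_root \<alpha>))"
  by (simp add: UNIV_label)

text \<open>The simple roots are solved for one by one. Six spanning vectors then form a basis by
  counting, so that \<open>representation\<close> in \<open>param_action\<close> yields the actual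
  coefficients.\<close>

lemma span_param_root: "span (range (param_root \<alpha>)) = UNIV"
proof -
  let ?S = "span (range (param_root \<alpha>))"
  \<comment> \<open>The formula of \<open>par_l\<close> with parameters replaced by their roots; it
    equals the sum of all simple roots.\<close>
  define lv where "lv = (1/3) *\<^sub>R (param_root \<alpha> M1 + 2 *\<^sub>R param_root \<alpha> M2 + param_root \<alpha> M1' + 2 *\<^sub>R param_root \<alpha> M2'
     - param_root \<alpha> M1'' - 2 *\<^sub>R param_root \<alpha> M2'')"
  have r: "param_root \<alpha> k \<in> ?S" for k by (intro span_base rangeI)
  have l: "lv \<in> ?S"
    unfolding lv_def by (intro span_scale span_add span_diff r)
  have l_eq: "lv = \<alpha> 1 + \<alpha> 2 + \<alpha> 3 + \<alpha> 4 + \<alpha> 5 + \<alpha> 6"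
    by (simp add: lv_def Finite_Cartesian_Product.vec_eq_iff)
  have 1: "\<alpha> 1 \<in> ?S" using span_diff[OF l r[of M2']] by (simp add: l_eq)
  have 5: "\<alpha> 5 \<in> ?S" using span_diff[OF l r[of M2]] by (simp add: l_eq)
  have 23: "\<alpha> 2 + \<alpha> 3 \<in> ?S" using span_diff[OF r[of M1'] 1] by (simp add: add.assoc)
  have 34: "\<alpha> 3 + \<alpha> 4 \<in> ?S" using span_diff[OF r[of M1] 5] by simp
  have 4: "\<alpha> 4 \<in> ?S" using span_diff[OF r[of M2''] 23] by simp
  have 3: "\<alpha> 3 \<in> ?S" using span_diff[OF 34 4] by simp
  have 2: "\<alpha> 2 \<in> ?S" using span_diff[OF 23 3] by simp
  have 6: "\<alpha> 6 \<in> ?S" using span_diff[OF r[of M1''] 3] by simp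
  have "\<alpha> ` {1..6} \<subseteq> ?S" using 1 2 3 4 5 6 by (auto simp: nodes)
  then have "span (\<alpha> ` {1..6}) \<subseteq> ?S" by (intro span_minimal subspace_span)
  then show ?thesis using span_simple_roots by auto
qed

lemma card_UNIV_label: "card (UNIV :: label set) = 6"
  by (simp add: UNIV_label)

lemma card_range_param_root: "card (range (param_root \<alpha>)) = 6"
proof (rule antisym)
  show "card (range (param_root \<alpha>)) \<le> 6"
    using card_image_le[of "UNIV :: label set" "param_root \<alpha>"] card_UNIV_label by (simp add: UNIV_label)
  have "dim (UNIV :: (real^6) set) \<le> card (range (param_root \<alpha>))"
    using span_param_root finite_range_param_root by (intro dim_le_card) auto
  then show "6 \<le> card (range (param_root \<alpha>))" by simp
qed

lemma inj_param_root: "inj (param_root \<alpha>)"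
proof (rule eq_card_imp_inj_on)
  show "finite (UNIV :: label set)" by (simp add: UNIV_label)
qed (simp only: card_range_param_root card_UNIV_label)

lemma independent_param_root: "independent (range (param_root \<alpha>))"
  by (rule card_le_dim_spanning[of _ UNIV])
     (use span_param_root finite_range_param_root card_range_param_root in auto)

lemma ex_linear_params:
  fixes m :: params
  shows "\<exists>f. linear f \<and> m = (\<lambda>k. f (param_root \<alpha> k))"
proof -
  obtain f where "linear f"
    "\<forall>x\<in>range (param_root \<alpha>). f x = m (inv_into UNIV (param_root \<alpha>) x)"
    using linear_independent_extend[OF independent_param_root,
        of "\<lambda>x. m (inv_into UNIV (param_root \<alpha>) x)"] by (elim exE conjE)
  then show ?thesis
    using inv_f_f[OF inj_param_root] by (intro exI[of _ f]) (simp add: fun_eq_iff)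
qed

text \<open>Expanding \<open>g (param_root \<alpha> k)\<close> in the basis and applying
  \<open>f\<close> gives the sum that defines the action. All later computations go through this
  form and avoid \<open>representation\<close>.\<close>

lemma param_action_functional:
  assumes "linear f"
  shows "param_action \<alpha> g (\<lambda>k. f (param_root \<alpha> k)) = (\<lambda>k. f (g (param_root \<alpha> k)))"
proof
  fix k
  let ?R = "range (param_root \<alpha>)" and ?v = "g (param_root \<alpha> k)"
  have "param_action \<alpha> g (\<lambda>k. f (param_root \<alpha> k)) k = (\<Sum>b\<in>?R. representation ?R ?v b * f b)"
    unfolding param_action_def by (simp add: sum.reindex[OF inj_param_root] o_def)
  also have "\<dots> = f (\<Sum>b\<in>?R. representation ?R ?v b *\<^sub>R b)"
    by (simp add: linear_sum[OF assms] linear_scale[OF assms])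
  also have "(\<Sum>b\<in>?R. representation ?R ?v b *\<^sub>R b) = ?v"
    by (rule sum_representation_eq[OF independent_param_root])
       (use span_param_root finite_range_param_root in auto)
  finally show "param_action \<alpha> g (\<lambda>k. f (param_root \<alpha> k)) k = f ?v" .
qed

text \<open>Precomposition reverses the order of factors. Linearity of \<open>g\<close> ensures that
  \<open>f\<close> after \<open>g\<close> is again a linear functional.\<close>

lemma param_action_comp:
  assumes "linear g"
  shows "param_action \<alpha> (g \<circ> h) = param_action \<alpha> h \<circ> param_action \<alpha> g"
proof
  fix m :: params
  obtain f where f: "linear f" "m = (\<lambda>k. f (param_root \<alpha> k))" using ex_linear_params by blast
  have "linear (\<lambda>x. f (g x))" using linear_compose[OF assms f(1)] by (simp add: o_def)
  from param_action_functional[OF this, of h]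
  show "param_action \<alpha> (g \<circ> h) m = (param_action \<alpha> h \<circ> param_action \<alpha> g) m"
    by (simp add: f(2) param_action_functional[OF f(1)])
qed

lemma param_action_id: "param_action \<alpha> id = id"
proof
  fix m :: params
  obtain f where f: "linear f" "m = (\<lambda>k. f (param_root \<alpha> k))" using ex_linear_params by blast
  show "param_action \<alpha> id m = id m"
    by (simp add: f(2) param_action_functional[OF f(1)])
qed

text \<open>The functionals given by inner products with fixed vectors separate the images of the
  parameter roots, and these roots span.\<close>

lemma param_action_inj:
  assumes "linear g" "linear h" "param_action \<alpha> g = param_action \<alpha> h"
  shows "g = h"
proof
  fix x
  have "g (param_root \<alpha> k) = h (param_root \<alpha> k)" for k
  proof -
    have "inner (g (param_root \<alpha> k)) y = inner (h (param_root \<alpha> k)) y" for y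
    proof -
      have "linear (\<lambda>x. inner x y)" by (rule linearI) (auto simp: inner_left_distrib)
      from param_action_functional[OF this, of g] param_action_functional[OF this, of h]
      show ?thesis using assms(3) by (metis (no_types))
    qed
    then show ?thesis using vector_eq_rdot by blast
  qed
  then show "g x = h x"
    using linear_eq_on[OF assms(1,2), of x "range (param_root \<alpha>)"] span_param_root by auto
qed

lemma functional_mk_params:
  assumes "linear f"
  shows "(\<lambda>k. f (param_root \<alpha> k)) = mk_params (f (\<alpha> 1)) (f (\<alpha> 2)) (f (\<alpha> 3)) (f (\<alpha> 4)) (f (\<alpha> 5)) (f (\<alpha> 6))"
proof
  fix k
  show "f (param_root \<alpha> k) = mk_params (f (\<alpha> 1)) (f (\<alpha> 2)) (f (\<alpha> 3)) (f (\<alpha> 4)) (f (\<alpha> 5)) (f (\<alpha> 6)) k"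
    by (cases k) (simp_all add: linear_add[OF assms])
qed

lemma ex_functional_mk_params:
  "\<exists>h. linear h \<and> h (\<alpha> 1) = a \<and> h (\<alpha> 2) = b \<and> h (\<alpha> 3) = c \<and> h (\<alpha> 4) = d \<and> h (\<alpha> 5) = e \<and> h (\<alpha> 6) = f"
  for a b c d e f :: real
proof -
  obtain h :: "real^6 \<Rightarrow> real" where "linear h" "\<forall>i\<in>{1..6}. h (\<alpha> i) = [0, a, b, c, d, e, f] ! i"
    using ex_linear_simple_roots by blast
  then show ?thesis by (intro exI[of _ h]) (simp add: nodes numeral_eq_Suc)
qed

lemma param_action_mk_params:
  assumes "linear g" "linear h" "h (\<alpha> 1) = a" "h (\<alpha> 2) = b" "h (\<alpha> 3) = c" "h (\<alpha> 4) = d" "h (\<alpha> 5) = e" "h (\<alpha> 6) = f"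
  shows "param_action \<alpha> g (mk_params a b c d e f) =
    mk_params (h (g (\<alpha> 1))) (h (g (\<alpha> 2))) (h (g (\<alpha> 3))) (h (g (\<alpha> 4))) (h (g (\<alpha> 5))) (h (g (\<alpha> 6)))"
proof -
  have "linear (\<lambda>x. h (g x))" using linear_compose[OF assms(1,2)] by (simp add: o_def)
  from functional_mk_params[OF this] functional_mk_params[OF assms(2)] assms(3-)
  show ?thesis using param_action_functional[OF assms(2), of g] by simp
qed

text \<open>The values at the simple roots transform by the reflection formula: the value at the
  reflected node changes sign and is added to its neighbours. The generator 0 reverses the chain of
  five nodes.\<close>

lemma param_action_ml_gen:
  "param_action \<alpha> (ml_gen 0) (mk_params a b c d e f) = mk_params e d c b a f"
  "param_action \<alpha> (ml_gen 1) (mk_params a b c d e f) = mk_params (- a) (a + b) c d e f"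
  "param_action \<alpha> (ml_gen 2) (mk_params a b c d e f) = mk_params (a + b) (- b) (b + c) d e f"
  "param_action \<alpha> (ml_gen 4) (mk_params a b c d e f) = mk_params a b (c + d) (- d) (d + e) f"
  "param_action \<alpha> (ml_gen 5) (mk_params a b c d e f) = mk_params a b c (d + e) (- e) f"
  "param_action \<alpha> (ml_gen 6) (mk_params a b c d e f) = mk_params a b (c + f) d e (- f)"
proof -
  obtain h :: "real^6 \<Rightarrow> real" where h: "linear h" "h (\<alpha> 1) = a" "h (\<alpha> 2) = b" "h (\<alpha> 3) = c" "h (\<alpha> 4) = d"
      "h (\<alpha> 5) = e" "h (\<alpha> 6) = f"
    using ex_functional_mk_params by blast
  note act = param_action_mk_params[OF linear_ml_gen h]
  have hs: "h (simple_refl \<alpha> i (\<alpha> j)) = h (\<alpha> j) - inner (\<alpha> j) (\<alpha> i) * h (\<alpha> i)" for i j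
    by (simp add: simple_refl_def linear_diff[OF h(1)] linear_scale[OF h(1)])
  have fl: "dual_flip (\<alpha> 1) = \<alpha> 5" "dual_flip (\<alpha> 2) = \<alpha> 4" "dual_flip (\<alpha> 3) = \<alpha> 3"
    "dual_flip (\<alpha> 4) = \<alpha> 2" "dual_flip (\<alpha> 5) = \<alpha> 1" "dual_flip (\<alpha> 6) = \<alpha> 6"
    by (simp_all add: dual_flip_simple_root flip_def One_nat_def)
  show "param_action \<alpha> (ml_gen 0) (mk_params a b c d e f) = mk_params e d c b a f"
    unfolding act by (simp only: ml_gen_def fl h if_True simp_thms)
  show "param_action \<alpha> (ml_gen 1) (mk_params a b c d e f) = mk_params (- a) (a + b) c d e f"
    unfolding act by (simp add: ml_gen_def hs h inner_simple_roots e6_adjacent_iff add.commute)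
  show "param_action \<alpha> (ml_gen 2) (mk_params a b c d e f) = mk_params (a + b) (- b) (b + c) d e f"
    unfolding act by (simp add: ml_gen_def hs h inner_simple_roots e6_adjacent_iff add.commute)
  show "param_action \<alpha> (ml_gen 4) (mk_params a b c d e f) = mk_params a b (c + d) (- d) (d + e) f"
    unfolding act by (simp add: ml_gen_def hs h inner_simple_roots e6_adjacent_iff add.commute)
  show "param_action \<alpha> (ml_gen 5) (mk_params a b c d e f) = mk_params a b c (d + e) (- e) f"
    unfolding act by (simp add: ml_gen_def hs h inner_simple_roots e6_adjacent_iff add.commute)
  show "param_action \<alpha> (ml_gen 6) (mk_params a b c d e f) = mk_params a b (c + f) d e (- f)"
    unfolding act by (simp add: ml_gen_def hs h inner_simple_roots e6_adjacent_iff add.commute)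
qed


definition ml_word :: "nat list \<Rightarrow> real^6 \<Rightarrow> real^6" where
  "ml_word ks = foldr (\<lambda>k g. ml_gen k \<circ> g) ks id"

lemma ml_word_in: "set ks \<subseteq> {0, 1, 2, 4, 5, 6} \<Longrightarrow> ml_word ks \<in> missing_label_subgroup \<alpha>"
proof (induction ks)
  case Nil
  have "ml_word [] = id" by (simp add: ml_word_def fun_eq_iff)
  then show ?case using id_in_missing_label_subgroup by (simp only:)
next
  case (Cons k ks)
  then have "ml_gen k \<circ> ml_word ks \<in> missing_label_subgroup \<alpha>"
    by (intro comp_in_missing_label_subgroup ml_gen_in) auto
  moreover have "ml_word (k # ks) = ml_gen k \<circ> ml_word ks"
    by (simp add: ml_word_def fun_eq_iff)
  ultimately show ?case by (simp only:)
qed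

text \<open>As the action reverses composition, the leftmost letter acts first on the
  parameters.\<close>

lemma param_action_ml_word:
  "param_action \<alpha> (ml_word []) m = m"
  "param_action \<alpha> (ml_word (k # ks)) m = param_action \<alpha> (ml_word ks) (param_action \<alpha> (ml_gen k) m)"
proof -
  show "param_action \<alpha> (ml_word []) m = m"
    using fun_cong[OF param_action_id, of m] by (simp add: ml_word_def)
  have "ml_word (k # ks) = ml_gen k \<circ> ml_word ks"
    by (simp only: ml_word_def foldr_Cons o_apply)
  then show "param_action \<alpha> (ml_word (k # ks)) m = param_action \<alpha> (ml_word ks) (param_action \<alpha> (ml_gen k) m)"
    using fun_cong[OF param_action_comp[OF linear_ml_gen[of k], of "ml_word ks"], of m] by simp
qed

end

section \<open>Operations on the pair of squares\<close>

lemma permute_rows_comp: "permute_rows p (permute_rows q s) = permute_rows (q \<circ> p) s"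
  by (cases s) (simp add: permute_rows_def)

lemma permute_columns_comp: "permute_columns p (permute_columns q s) = permute_columns (q \<circ> p) s"
  by (cases s) (simp add: permute_columns_def)

lemma permute_rows_id: "permute_rows id s = s"
  by (cases s) (simp add: permute_rows_def)

lemma permute_columns_id: "permute_columns id s = s"
  by (cases s) (simp add: permute_columns_def)

lemma permute_rows_inv:
  assumes "bij p"
  shows "permute_rows p (permute_rows (inv_into UNIV p) s) = s"
    "permute_rows (inv_into UNIV p) (permute_rows p s) = s"
  using bij_is_inj[OF assms] bij_is_surj[OF assms] 
  by (simp_all only: permute_rows_comp inv_o_cancel surj_iff permute_rows_id)

lemma permute_columns_inv:
  assumes "bij p"
  shows "permute_columns p (permute_columns (inv_into UNIV p) s) = s"
    "permute_columns (inv_into UNIV p) (permute_columns p s) = s"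
  using bij_is_inj[OF assms] bij_is_surj[OF assms] 
  by (simp_all only: permute_columns_comp inv_o_cancel surj_iff permute_columns_id)

definition square_gens :: "(squares \<Rightarrow> squares) set" where
  "square_gens = {permute_rows p | p. bij p} \<union> {permute_columns p | p. bij p} \<union>
      {map_prod transpose transpose, prod.swap}"

text \<open>The generating set is closed under inverses, so induction over the generated group can
  dispense with a separate case for inverses.\<close>

lemma square_gens_inverse:
  assumes "s \<in> square_gens"
  shows "\<exists>s'\<in>square_gens. \<forall>x. s (s' x) = x \<and> s' (s x) = x"
  using assms[unfolded square_gens_def]
proof (elim UnE CollectE exE conjE insertE)
  fix p :: "3 \<Rightarrow> 3" assume "s = permute_rows p" "bij p"
  then show ?thesis
    using permute_rows_inv[of p] bij_imp_bij_inv[of p]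
    by (intro bexI[of _ "permute_rows (inv_into UNIV p)"]) (auto simp: square_gens_def)
next
  fix p :: "3 \<Rightarrow> 3" assume "s = permute_columns p" "bij p"
  then show ?thesis
    using permute_columns_inv[of p] bij_imp_bij_inv[of p]
    by (intro bexI[of _ "permute_columns (inv_into UNIV p)"]) (auto simp: square_gens_def)
next
  assume "s = map_prod transpose transpose"
  then show ?thesis by (intro bexI[of _ s]) (auto simp: square_gens_def)
next
  assume "s = prod.swap"
  then show ?thesis by (intro bexI[of _ s]) (auto simp: square_gens_def)
qed simp

lemma bij_square_gens: "s \<in> square_gens \<Longrightarrow> bij s"
  using square_gens_inverse[of s] by (metis bijI')

lemma square_operations_eq: "square_operations = generate (BijGroup UNIV) square_gens"
  by (simp only: square_operations_def square_gens_def)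

lemma square_operations_induct [consumes 1, case_names id gen comp]:
  assumes "s \<in> square_operations" "P id" "\<And>s. s \<in> square_gens \<Longrightarrow> P s"
    and "\<And>s t. s \<in> square_operations \<Longrightarrow> t \<in> square_operations \<Longrightarrow> P s \<Longrightarrow> P t \<Longrightarrow> P (s \<circ> t)"
  shows "P s"
  using assms(1) unfolding square_operations_eq
proof (induction rule: generate_BijGroup_induct)
  case id
  show ?case by (rule assms(2))
next
  case (bij h)
  then show ?case by (rule bij_square_gens)
next
  case (gen h)
  then show ?case by (rule assms(3))
next
  case (inv h)
  then obtain h' where h': "h' \<in> square_gens" "\<And>x. h (h' x) = x" "\<And>x. h' (h x) = x"
    using square_gens_inverse[of h] by blast
  then have "inv_into UNIV h = h'" by (intro inv_unique_comp) (auto simp: fun_eq_iff)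
  then show ?case using h'(1) assms(3) by simp
next
  case (comp g h)
  then show ?case using assms(4) unfolding square_operations_eq by blast
qed

lemma square_operations_comp:
  "s \<in> square_operations \<Longrightarrow> t \<in> square_operations \<Longrightarrow> s \<circ> t \<in> square_operations"
  unfolding square_operations_eq using bij_square_gens by (intro generate_BijGroup_comp)

lemma square_gens_in: "s \<in> square_gens \<Longrightarrow> s \<in> square_operations"
  unfolding square_operations_eq by (rule generate.incl)

lemma permute_rows_in: "bij p \<Longrightarrow> permute_rows p \<in> square_operations"
  and permute_columns_in: "bij p \<Longrightarrow> permute_columns p \<in> square_operations"
  and transpose_in: "map_prod transpose transpose \<in> square_operations"
  and swap_in: "prod.swap \<in> square_operations"
  by (rule square_gens_in; auto simp: square_gens_def)+

lemma id_in_square_operations: "id \<in> square_operations"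
  by (simp add: square_operations_eq generate_BijGroup_id)

section \<open>Matching the subgroup with the operations on the arrangement\<close>

context e6
begin

lemma arr_transposed_permuted:
  "permute_rows p (permute_columns q (transpose A, transpose B)) =
     (\<chi> i j. A $ q j $ p i, \<chi> i j. B $ q j $ p i)"
  by (simp add: permute_rows_def permute_columns_def transpose_def)

text \<open>The generator 0 exchanges the first two columns, the nodes 1, 2, 4 and 5 act as the
  transposition up to row and column permutations, and node 6 exchanges the squares.\<close>

lemma arr_param_action_ml_gen:
  assumes "i \<in> {0, 1, 2, 4, 5, 6}"
  shows "\<exists>s\<in>square_operations. \<forall>m. arr (param_action \<alpha> (ml_gen i) m) = s (arr m)"
proof -
  let ?tr = "map_prod transpose transpose"
  have tr: "permute_rows p \<circ> (permute_columns q \<circ> ?tr) \<in> square_operations" if "bij p" "bij q" for p q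
    by (intro square_operations_comp permute_rows_in permute_columns_in transpose_in that)
  from assms consider "i = 0" | "i = 1" | "i = 2" | "i = 4" | "i = 5" | "i = 6" by blast
  then show ?thesis
  proof cases
    case 1
    show ?thesis
    proof (rule bexI[of _ "permute_columns (perm3 2 1 3)"], rule allI)
      show "arr (param_action \<alpha> (ml_gen i) m) = permute_columns (perm3 2 1 3) (arr m)" for m
        by (cases m rule: mk_params_exhaust) (simp add: 1 param_action_ml_gen arr_mk_params
            permute_columns_def Finite_Cartesian_Product.vec_eq_iff forall_3)
    qed (intro permute_columns_in bij_perm3, simp)
  next
    case 2
    show ?thesis
    proof (rule bexI[of _ ?tr], rule allI)
      show "arr (param_action \<alpha> (ml_gen i) m) = ?tr (arr m)" for m
        by (cases m rule: mk_params_exhaust) (simp add: 2 param_action_ml_gen arr_mk_params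
            transpose_def Finite_Cartesian_Product.vec_eq_iff forall_3)
    qed (rule transpose_in)
  next
    case 3
    show ?thesis
    proof (rule bexI[OF _ tr[of "perm3 2 3 1" "perm3 3 1 2"]], rule allI)
      show "arr (param_action \<alpha> (ml_gen i) m) = (permute_rows (perm3 2 3 1) \<circ> (permute_columns (perm3 3 1 2) \<circ> ?tr)) (arr m)" for m
        by (cases m rule: mk_params_exhaust) (simp add: 3 param_action_ml_gen arr_mk_params
            arr_transposed_permuted Finite_Cartesian_Product.vec_eq_iff forall_3)
    qed (rule bij_perm3; simp)+
  next
    case 4
    show ?thesis
    proof (rule bexI[OF _ tr[of "perm3 1 3 2" "perm3 1 3 2"]], rule allI)
      show "arr (param_action \<alpha> (ml_gen i) m) = (permute_rows (perm3 1 3 2) \<circ> (permute_columns (perm3 1 3 2) \<circ> ?tr)) (arr m)" for m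
        by (cases m rule: mk_params_exhaust) (simp add: 4 param_action_ml_gen arr_mk_params
            arr_transposed_permuted Finite_Cartesian_Product.vec_eq_iff forall_3)
    qed (rule bij_perm3; simp)+
  next
    case 5
    show ?thesis
    proof (rule bexI[OF _ tr[of "perm3 2 1 3" "perm3 2 1 3"]], rule allI)
      show "arr (param_action \<alpha> (ml_gen i) m) = (permute_rows (perm3 2 1 3) \<circ> (permute_columns (perm3 2 1 3) \<circ> ?tr)) (arr m)" for m
        by (cases m rule: mk_params_exhaust) (simp add: 5 param_action_ml_gen arr_mk_params
            arr_transposed_permuted Finite_Cartesian_Product.vec_eq_iff forall_3)
    qed (rule bij_perm3; simp)+
  next
    case 6
    show ?thesis
    proof (rule bexI[of _ prod.swap], rule allI)
      show "arr (param_action \<alpha> (ml_gen i) m) = prod.swap (arr m)" for m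
        by (cases m rule: mk_params_exhaust) (simp add: 6 param_action_ml_gen arr_mk_params
            Finite_Cartesian_Product.vec_eq_iff forall_3)
    qed (rule swap_in)
  qed
qed

lemma arr_param_action:
  assumes "g \<in> missing_label_subgroup \<alpha>"
  shows "\<exists>s\<in>square_operations. \<forall>m. arr (param_action \<alpha> g m) = s (arr m)"
  using assms
proof (induction rule: missing_label_subgroup_induct)
  case id
  show ?case
    by (rule bexI[OF _ id_in_square_operations], unfold param_action_id) simp
next
  case (gen i)
  then show ?case by (rule arr_param_action_ml_gen)
next
  case (comp g h)
  then obtain s t where st: "s \<in> square_operations" "\<And>m. arr (param_action \<alpha> g m) = s (arr m)"
    "t \<in> square_operations" "\<And>m. arr (param_action \<alpha> h m) = t (arr m)" by blast
  show ?case
  proof (rule bexI[OF _ square_operations_comp[OF st(3,1)]], rule allI)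
    fix m
    show "arr (param_action \<alpha> (g \<circ> h) m) = (t \<circ> s) (arr m)"
      using st(2,4) param_action_comp[OF linear_missing_label_subgroup[OF comp(1)], of h] by simp
  qed
qed

text \<open>Here and for columns, a cyclic permutation is a rotation in each of the
  \<open>A_2\<close> factors on nodes 1, 2 and on nodes 4, 5. A row transposition is the flip 0 with
  a reflection in each factor; a column transposition is the flip alone or with two
  rotations.\<close>

lemma arr_param_action_permute_rows:
  "arr (param_action \<alpha> (ml_word []) m) = permute_rows (perm3 1 2 3) (arr m)"
  "arr (param_action \<alpha> (ml_word [0, 4, 5, 4, 1, 2, 1]) m) = permute_rows (perm3 1 3 2) (arr m)"
  "arr (param_action \<alpha> (ml_word [0, 5, 1]) m) = permute_rows (perm3 2 1 3) (arr m)"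
  "arr (param_action \<alpha> (ml_word [4, 5, 2, 1]) m) = permute_rows (perm3 2 3 1) (arr m)"
  "arr (param_action \<alpha> (ml_word [5, 4, 1, 2]) m) = permute_rows (perm3 3 1 2) (arr m)"
  "arr (param_action \<alpha> (ml_word [0, 4, 2]) m) = permute_rows (perm3 3 2 1) (arr m)"
  by (cases m rule: mk_params_exhaust; simp add: param_action_ml_word param_action_ml_gen arr_mk_params
       permute_rows_def Finite_Cartesian_Product.vec_eq_iff forall_3)+

lemma arr_param_action_permute_columns:
  "arr (param_action \<alpha> (ml_word []) m) = permute_columns (perm3 1 2 3) (arr m)"
  "arr (param_action \<alpha> (ml_word [0, 4, 5, 1, 2]) m) = permute_columns (perm3 1 3 2) (arr m)"
  "arr (param_action \<alpha> (ml_word [0]) m) = permute_columns (perm3 2 1 3) (arr m)"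
  "arr (param_action \<alpha> (ml_word [4, 5, 1, 2]) m) = permute_columns (perm3 2 3 1) (arr m)"
  "arr (param_action \<alpha> (ml_word [5, 4, 2, 1]) m) = permute_columns (perm3 3 1 2) (arr m)"
  "arr (param_action \<alpha> (ml_word [0, 5, 4, 2, 1]) m) = permute_columns (perm3 3 2 1) (arr m)"
  by (cases m rule: mk_params_exhaust; simp add: param_action_ml_word param_action_ml_gen arr_mk_params
       permute_columns_def Finite_Cartesian_Product.vec_eq_iff forall_3)+

lemma arr_param_action_transpose_swap:
  "arr (param_action \<alpha> (ml_word [1]) m) = map_prod transpose transpose (arr m)"
  "arr (param_action \<alpha> (ml_word [6]) m) = prod.swap (arr m)"
  by (cases m rule: mk_params_exhaust; simp add: param_action_ml_word param_action_ml_gen arr_mk_params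
       transpose_def Finite_Cartesian_Product.vec_eq_iff forall_3)+

text \<open>Converse direction: the six permutations of three indices are covered by the two tables
  of words, the remaining generators by one letter each.\<close>

lemma square_operation_realized:
  assumes "s \<in> square_operations"
  shows "\<exists>g\<in>missing_label_subgroup \<alpha>. \<forall>m. arr (param_action \<alpha> g m) = s (arr m)"
  using assms
proof (induction rule: square_operations_induct)
  case id
  show ?case
    by (rule bexI[OF _ id_in_missing_label_subgroup], unfold param_action_id) simp
next
  case (gen s)
  have word: "\<exists>ks. set ks \<subseteq> {0, 1, 2, 4, 5, 6} \<and> (\<forall>m. arr (param_action \<alpha> (ml_word ks) m) = t (arr m))"
    if "set ks \<subseteq> {0, 1, 2, 4, 5, 6}" "\<And>m. arr (param_action \<alpha> (ml_word ks) m) = t (arr m)" for t ks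
    using that by blast
  have "\<exists>ks. set ks \<subseteq> {0, 1, 2, 4, 5, 6} \<and> (\<forall>m. arr (param_action \<alpha> (ml_word ks) m) = s (arr m))"
    using gen[unfolded square_gens_def]
  proof (elim UnE CollectE exE conjE insertE)
    fix p :: "3 \<Rightarrow> 3" assume s: "s = permute_rows p" and p: "bij p"
    show ?thesis
      using bij_3_cases[OF p] unfolding s
      by (elim insertE emptyE; hypsubst)
         (rule word[OF _ arr_param_action_permute_rows(1)] word[OF _ arr_param_action_permute_rows(2)]
            word[OF _ arr_param_action_permute_rows(3)] word[OF _ arr_param_action_permute_rows(4)]
            word[OF _ arr_param_action_permute_rows(5)] word[OF _ arr_param_action_permute_rows(6)], simp)+
  next
    fix p :: "3 \<Rightarrow> 3" assume s: "s = permute_columns p" and p: "bij p"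
    show ?thesis
      using bij_3_cases[OF p] unfolding s
      by (elim insertE emptyE; hypsubst)
         (rule word[OF _ arr_param_action_permute_columns(1)] word[OF _ arr_param_action_permute_columns(2)]
            word[OF _ arr_param_action_permute_columns(3)] word[OF _ arr_param_action_permute_columns(4)]
            word[OF _ arr_param_action_permute_columns(5)] word[OF _ arr_param_action_permute_columns(6)], simp)+
  next
    assume "s = map_prod transpose transpose"
    then show ?thesis using arr_param_action_transpose_swap(1) by (intro exI[of _ "[1]"]) simp
  next
    assume "s = prod.swap"
    then show ?thesis using arr_param_action_transpose_swap(2) by (intro exI[of _ "[6]"]) simp
  qed simp
  then show ?case using ml_word_in by blast
next
  case (comp s t)
  then obtain g h where gh: "g \<in> missing_label_subgroup \<alpha>" "\<And>m. arr (param_action \<alpha> g m) = s (arr m)"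
    "h \<in> missing_label_subgroup \<alpha>" "\<And>m. arr (param_action \<alpha> h m) = t (arr m)" by blast
  \<comment> \<open>The witness is \<open>h \<circ> g\<close>, with the factors in reversed order,
    because the action on parameters reverses composition.\<close>
  show ?case
  proof (rule bexI[OF _ comp_in_missing_label_subgroup[OF gh(3,1)]], rule allI)
    fix m
    show "arr (param_action \<alpha> (h \<circ> g) m) = (s \<circ> t) (arr m)"
      using gh(2,4) param_action_comp[OF linear_missing_label_subgroup[OF gh(3)], of g] by simp
  qed
qed

text \<open>A symmetry agrees on the arrangement with the action of some element of the subgroup,
  and injectivity of \<open>arr\<close> upgrades this to equality of transformations.\<close>

lemma bij_betw_param_action: "bij_betw (param_action \<alpha>) (missing_label_subgroup \<alpha>) missing_label_symmetries"
proof (rule bij_betw_imageI)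
  show "inj_on (param_action \<alpha>) (missing_label_subgroup \<alpha>)"
    by (rule inj_onI) (rule param_action_inj[OF linear_missing_label_subgroup linear_missing_label_subgroup])
  show "param_action \<alpha> ` missing_label_subgroup \<alpha> = missing_label_symmetries"
  proof (intro subset_antisym subsetI)
    fix T assume "T \<in> missing_label_symmetries"
    then obtain s where s: "s \<in> square_operations" "\<And>m. arr (T m) = s (arr m)"
      by (auto simp: missing_label_symmetries_def)
    from square_operation_realized[OF s(1)] obtain g where
      g: "g \<in> missing_label_subgroup \<alpha>" "\<And>m. arr (param_action \<alpha> g m) = s (arr m)" by blast
    have "T = param_action \<alpha> g"
    proof
      fix m
      show "T m = param_action \<alpha> g m"
        using injD[OF inj_arr, of "T m" "param_action \<alpha> g m"] s(2) g(2) by simp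
    qed
    then show "T \<in> param_action \<alpha> ` missing_label_subgroup \<alpha>" using g(1) by blast
  next
    fix T assume "T \<in> param_action \<alpha> ` missing_label_subgroup \<alpha>"
    then show "T \<in> missing_label_symmetries"
      using arr_param_action by (auto simp: missing_label_symmetries_def)
  qed
qed

lemma missing_label_subgroup_subgroup:
  "subgroup (missing_label_subgroup \<alpha>) ((BijGroup UNIV)\<lparr>carrier := pm_weyl_group \<alpha>\<rparr>)"
proof -
  interpret group "BijGroup (UNIV :: (real^6) set)" by (rule group_BijGroup)
  have bij_weyl: "bij w" if "w \<in> weyl_group \<alpha>" for w
    using that generate_BijGroup_bij[of w "simple_refl \<alpha> ` {1..6}"] bij_simple_refl
    unfolding weyl_group_def by blast
  have bij_neg: "bij (uminus :: real^6 \<Rightarrow> real^6)"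
    by (rule bij_involution) simp
  have bij_pm: "bij h" if "h \<in> insert uminus (weyl_group \<alpha>)" for h
    using that bij_weyl bij_neg by blast
  have pm: "subgroup (pm_weyl_group \<alpha>) (BijGroup UNIV)"
    unfolding pm_weyl_group_def
    by (rule generate_is_subgroup) (use bij_pm in \<open>auto simp: carrier_BijGroup_UNIV\<close>)
  have ml: "subgroup (missing_label_subgroup \<alpha>) (BijGroup UNIV)"
    unfolding missing_label_subgroup_eq
    by (rule generate_is_subgroup) (use bij_ml_gen in \<open>auto simp: carrier_BijGroup_UNIV\<close>)
  have weyl_pm: "weyl_group \<alpha> \<subseteq> pm_weyl_group \<alpha>"
    unfolding pm_weyl_group_def by (auto intro: generate.incl)
  have refl: "simple_refl \<alpha> i \<in> weyl_group \<alpha>" if "i \<in> {1..6}" for i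
    using that unfolding weyl_group_def by (intro generate.incl imageI)
  have longest: "longest_element \<alpha> \<in> weyl_group \<alpha>"
    unfolding longest_element_eq weyl_group_iff using longest_word_nodes by blast
  \<comment> \<open>The generator \<open>-w_0\<close> is a product of \<open>uminus\<close> and a
    Weyl group element, so it lies in the larger group.\<close>
  have "uminus \<circ> longest_element \<alpha> \<in> pm_weyl_group \<alpha>"
    using longest weyl_pm unfolding pm_weyl_group_def
    by (intro generate_BijGroup_comp bij_pm) (auto intro: generate.incl)
  then have "dual_flip \<in> pm_weyl_group \<alpha>" by (simp add: o_def)
  then have "simple_refl \<alpha> ` {1, 2, 4, 5, 6} \<union> {dual_flip} \<subseteq> pm_weyl_group \<alpha>"
    using refl weyl_pm by force
  then have "missing_label_subgroup \<alpha> \<subseteq> pm_weyl_group \<alpha>"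
    unfolding missing_label_subgroup_def by (rule generate_subgroup_incl) (rule pm)
  then show ?thesis using subgroup_incl[OF ml pm] by blast
qed

end

section \<open>Symmetries of the matrices\<close>

text \<open>Multisets rather than lists, since all matrix coefficients are symmetric in the first
  three and in the last three of the \<open>xi\<close>. Permutations of these then become
  invisible.\<close>

definition tops :: "params \<Rightarrow> real multiset" where
  "tops m = image_mset (xi m) (mset_set {1..3})"

definition bots :: "params \<Rightarrow> real multiset" where
  "bots m = image_mset (xi m) (mset_set {4..6})"

lemma interval_1_3: "{1..3::nat} = {1, 2, 3}" and interval_4_6: "{4..6::nat} = {4, 5, 6}"
  and interval_1_6: "{1..6::nat} = {1..3} \<union> {4..6}"
  by auto

lemma prod_1_3: "(\<Prod>i=1..3. F (xi m i)) = prod_mset (image_mset F (tops m))"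
  and prod_4_6: "(\<Prod>i=4..6. F (xi m i)) = prod_mset (image_mset F (bots m))"
  for F :: "real \<Rightarrow> real"
  by (simp_all add: tops_def bots_def prod_unfold_prod_mset multiset.map_comp o_def)

lemma sum_1_3: "(\<Sum>i=1..3. F (xi m i)) = sum_mset (image_mset F (tops m))"
  and sum_4_6: "(\<Sum>i=4..6. F (xi m i)) = sum_mset (image_mset F (bots m))"
  for F :: "real \<Rightarrow> real"
  by (simp_all add: tops_def bots_def sum_unfold_sum_mset multiset.map_comp o_def)

lemma sum_1_6: "(\<Sum>i=1..6. F (xi m i)) = sum_mset (image_mset F (tops m)) + sum_mset (image_mset F (bots m))"
  for F :: "real \<Rightarrow> real"
  by (subst interval_1_6, subst sum.union_disjoint) (simp_all only: sum_1_3 sum_4_6, auto)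

lemma xi_a_tops: "xi_a m = Min (set_mset (tops m))"
  and xi_b_bots: "xi_b m = Max (set_mset (bots m))"
  by (simp_all add: xi_a_def xi_b_def tops_def bots_def)

lemma size_tops: "size (tops m) = 3" and size_bots: "size (bots m) = 3"
  by (simp_all add: tops_def bots_def)

lemma EE_mset:
  "EE m j k = sum_mset (image_mset (\<lambda>x. (x - real j - xi_b m + 1/2) ^ k) (tops m))
     + sum_mset (image_mset (\<lambda>x. (x - real j - xi_b m + 1/2) ^ k) (bots m))"
  by (simp only: EE_def sum_1_6[of "\<lambda>x. (x - real j - xi_b m + 1/2) ^ k"])

lemma Lam_mset: "Lam m = sum_mset (tops m) - sum_mset (bots m) + 2 * \<bar>par_l m - par_n m\<bar>"
  using sum_1_3[of "\<lambda>x. x" m] sum_4_6[of "\<lambda>x. x" m] by (simp add: Lam_def)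

lemma a_upper_mset: "a_upper m j = prod_mset (image_mset (\<lambda>x. real j + xi_b m - x) (tops m))"
  and a_lower_mset: "a_lower m j = prod_mset (image_mset (\<lambda>x. real j + xi_b m - x) (bots m))"
  by (simp_all only: a_upper_def a_lower_def prod_1_3[of "\<lambda>x. real j + xi_b m - x"] prod_4_6[of "\<lambda>x. real j + xi_b m - x"])

lemma lam_mset:
  "lam_plus m = Lam m / 2 + (sum_mset (tops m) + sum_mset (bots m)) / 6"
  "lam_minus m = - Lam m / 2 + (sum_mset (tops m) + sum_mset (bots m)) / 6"
  using sum_1_6[of "\<lambda>x. x" m] by (simp_all add: lam_plus_def lam_minus_def)

lemma sum_mset_shift: "sum_mset (image_mset (\<lambda>x. s + x) M) = real (size M) * s + sum_mset M"
  by (induction M) (auto simp: algebra_simps)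

lemma sum_mset_reflect: "sum_mset (image_mset (\<lambda>x. t - x) M) = real (size M) * t - sum_mset M"
  by (induction M) (auto simp: algebra_simps)

lemma Min_shift: "finite A \<Longrightarrow> A \<noteq> {} \<Longrightarrow> Min ((+) s ` A) = s + Min A" for s :: real
  by (intro Min_eqI) (auto intro!: Min_in)

lemma Max_shift: "finite A \<Longrightarrow> A \<noteq> {} \<Longrightarrow> Max ((+) s ` A) = s + Max A" for s :: real
  by (intro Max_eqI) (auto intro!: Max_in)

lemma Min_reflect: "finite A \<Longrightarrow> A \<noteq> {} \<Longrightarrow> Min ((-) t ` A) = t - Max A" for t :: real
  by (intro Min_eqI) (auto intro!: Max_in)

lemma Max_reflect: "finite A \<Longrightarrow> A \<noteq> {} \<Longrightarrow> Max ((-) t ` A) = t - Min A" for t :: real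
  by (intro Max_eqI) (auto intro!: Min_in)

lemma tops_nonempty: "tops m \<noteq> {#}" and bots_nonempty: "bots m \<noteq> {#}"
  using size_tops[of m] size_bots[of m] by auto

text \<open>The entries involve the \<open>xi\<close> and \<open>lam_plus\<close>,
  \<open>lam_minus\<close> only through differences with \<open>xi_b\<close>. In \<open>Lam\<close>
  the shifts of the two triples cancel.\<close>

lemma shift_invariant:
  assumes "tops m' = image_mset (\<lambda>x. s + x) (tops m)" "bots m' = image_mset (\<lambda>x. s + x) (bots m)"
    and "\<bar>par_l m' - par_n m'\<bar> = \<bar>par_l m - par_n m\<bar>"
  shows "xi_a m' - xi_b m' = xi_a m - xi_b m" "X_mat m' = X_mat m" "Y_mat m' = Y_mat m"
proof -
  have a: "xi_a m' = s + xi_a m" and b: "xi_b m' = s + xi_b m"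
    by (simp_all add: xi_a_tops xi_b_bots assms(1,2) Min_shift Max_shift tops_nonempty bots_nonempty)
  show "xi_a m' - xi_b m' = xi_a m - xi_b m" by (simp add: a b)
  then have d: "mat_size m' = mat_size m" by (simp add: mat_size_def)
  have S: "sum_mset (tops m') = 3 * s + sum_mset (tops m)" "sum_mset (bots m') = 3 * s + sum_mset (bots m)"
    by (simp_all add: assms(1,2) sum_mset_shift size_tops size_bots)
  have L: "Lam m' = Lam m"
    by (simp add: Lam_mset S assms(3))
  have l: "lam_plus m' = s + lam_plus m" "lam_minus m' = s + lam_minus m"
    by (simp_all add: lam_mset L S field_simps)
  have E: "EE m' j k = EE m j k" for j k
    by (simp add: EE_mset assms(1,2) b multiset.map_comp o_def algebra_simps)
  have u: "a_upper m' = a_upper m" "a_lower m' = a_lower m"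
    by (simp_all add: fun_eq_iff a_upper_mset a_lower_mset assms(1,2) b multiset.map_comp o_def algebra_simps)
  have "a_diag m' = a_diag m" "b_diag m' = b_diag m"
    by (intro ext, simp only: a_diag_def b_diag_def E L)+
  moreover have "b_upper m' = b_upper m" "b_lower m' = b_lower m"
    by (simp_all add: fun_eq_iff b_upper_def b_lower_def u b l)
  ultimately show "X_mat m' = X_mat m" "Y_mat m' = Y_mat m"
    by (simp_all only: X_mat_def Y_mat_def d u)
qed

definition rev_mat :: "'a mat \<Rightarrow> 'a mat" where
  "rev_mat A = Matrix.mat (dim_row A) (dim_col A)
     (\<lambda>(i, j). A $$ (dim_row A - Suc i, dim_col A - Suc j))"

text \<open>The reflection exchanges the two triples, and thereby upper with lower coefficients and
  \<open>lam_plus\<close> with \<open>lam_minus\<close>. The products of three factors in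
  \<open>X\<close> change sign, while those in \<open>Y\<close> carry a fourth factor that restores
  it.\<close>

lemma reflect_reverses:
  assumes "tops m' = image_mset (\<lambda>x. t - x) (bots m)" "bots m' = image_mset (\<lambda>x. t - x) (tops m)"
    and "\<bar>par_l m' - par_n m'\<bar> = \<bar>par_l m - par_n m\<bar>"
  shows "xi_a m' - xi_b m' = xi_a m - xi_b m"
    and "xi_a m - xi_b m \<in> \<int> \<Longrightarrow> X_mat m' = - rev_mat (X_mat m)"
    and "xi_a m - xi_b m \<in> \<int> \<Longrightarrow> Y_mat m' = rev_mat (Y_mat m)"
proof -
  have a: "xi_a m' = t - xi_b m" and b: "xi_b m' = t - xi_a m"
    by (simp_all add: xi_a_tops xi_b_bots assms(1,2) Min_reflect Max_reflect tops_nonempty bots_nonempty)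
  show ab: "xi_a m' - xi_b m' = xi_a m - xi_b m" by (simp add: a b)
  then have d: "mat_size m' = mat_size m" by (simp add: mat_size_def)
  have S: "sum_mset (tops m') = 3 * t - sum_mset (bots m)" "sum_mset (bots m') = 3 * t - sum_mset (tops m)"
    by (simp_all add: assms(1,2) sum_mset_reflect size_tops size_bots)
  have L: "Lam m' = Lam m"
    by (simp add: Lam_mset S assms(3))
  have l: "lam_plus m' = t - lam_minus m" "lam_minus m' = t - lam_plus m"
    by (simp_all add: lam_mset L S field_simps)
  let ?d = "mat_size m"
  assume int: "xi_a m - xi_b m \<in> \<int>"
  \<comment> \<open>Integrality makes the truncated floor in \<open>mat_size\<close> exact. The
    guard excludes size 0, where the difference may be negative.\<close>
  have xi_a: "xi_a m = xi_b m + real ?d" if "?d > 0"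
  proof -
    from that have "xi_a m - xi_b m \<ge> 1" unfolding mat_size_def by linarith
    with int obtain z where z: "xi_a m - xi_b m = of_int z" by (auto elim: Ints_cases)
    with \<open>xi_a m - xi_b m \<ge> 1\<close> show ?thesis by (simp add: mat_size_def)
  qed
  \<comment> \<open>The summand 1/2 centres the power sums, so that the reflection sends
    \<open>j\<close> to \<open>?d + 1 - j\<close> with a sign for each odd power.\<close>
  have E: "EE m' j k = (-1) ^ k * EE m j' k" if "j + j' = ?d + 1" "?d > 0" for j j' k
  proof -
    have "t - x - real j - xi_b m' + 1/2 = - (x - real j' - xi_b m + 1/2)" for x
      using xi_a[OF that(2)] arg_cong[OF that(1), of real] by (simp add: b)
    then have *: "(t - x - real j - xi_b m' + 1/2) ^ k = (-1) ^ k * (x - real j' - xi_b m + 1/2) ^ k" for x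
      by (metis power_minus)
    have "EE m' j k = sum_mset (image_mset (\<lambda>x. (-1) ^ k * (x - real j' - xi_b m + 1/2) ^ k) (bots m))
      + sum_mset (image_mset (\<lambda>x. (-1) ^ k * (x - real j' - xi_b m + 1/2) ^ k) (tops m))"
      by (simp only: EE_mset assms(1,2) multiset.map_comp o_def *)
    then show ?thesis
      by (simp only: EE_mset[of m] distrib_left sum_mset_distrib_left add.commute)
  qed
  have prod3: "prod_mset (image_mset (\<lambda>x. - F x) M) = - prod_mset (image_mset F M)"
    if "size M = 3" for F :: "real \<Rightarrow> real" and M
  proof -
    have "prod_mset (image_mset (\<lambda>x. - F x) M) = (-1) ^ size M * prod_mset (image_mset F M)"
      by (induction M) auto
    then show ?thesis by (simp add: that)
  qed
  have refl: "real j + xi_b m' - (t - x) = - (real j' + xi_b m - x)" if "j + j' = ?d" "?d > 0" for j j' x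
    using xi_a[OF that(2)] arg_cong[OF that(1), of real] by (simp add: b)
  have u: "a_upper m' j = - a_lower m j'" "a_lower m' j = - a_upper m j'" if "j + j' = ?d" "?d > 0" for j j'
    by (simp_all add: a_upper_mset a_lower_mset assms(1,2) multiset.map_comp o_def refl[OF that]
        prod3 size_tops size_bots del: minus_diff_eq)
  \<comment> \<open>The sign of the three factors cancels against the sign of the factor with
    \<open>lam_minus\<close> or \<open>lam_plus\<close>.\<close>
  have v: "b_upper m' j = b_lower m j'" "b_lower m' j = b_upper m j'" if "j + j' = ?d" "?d > 0" for j j'
    by (simp_all only: b_upper_def b_lower_def u[OF that] l refl[OF that] minus_mult_minus)
  have diag: "a_diag m' j = - a_diag m j'" "b_diag m' j = b_diag m j'" if "j + j' = ?d + 1" "?d > 0" for j j'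
  proof -
    \<comment> \<open>Each term of \<open>a_diag\<close> has odd total weight in the power sums and
      each term of \<open>b_diag\<close> even weight, which decides the two signs.\<close>
    have E': "EE m' j 1 = - EE m j' 1" "EE m' j 2 = EE m j' 2" "EE m' j 3 = - EE m j' 3" "EE m' j 4 = EE m j' 4"
      using E[OF that, of 1] E[OF that, of 2] E[OF that, of 3] E[OF that, of 4] by simp_all
    show "a_diag m' j = - a_diag m j'" unfolding a_diag_def E' L by (simp add: algebra_simps)
    show "b_diag m' j = b_diag m j'" unfolding b_diag_def E' L by simp
  qed
  \<comment> \<open>Coefficients are indexed from 1. Reversing rows and columns therefore pairs
    off-diagonal indices with sum \<open>?d\<close> and diagonal indices with sum
    \<open>?d + 1\<close>.\<close>
  have sym: "tridiagonal ?d up di lo = rev_mat (tridiagonal ?d up' di' lo')"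
    if "\<And>j j'. j + j' = ?d \<Longrightarrow> ?d > 0 \<Longrightarrow> up j = lo' j'" "\<And>j j'. j + j' = ?d \<Longrightarrow> ?d > 0 \<Longrightarrow> lo j = up' j'"
      "\<And>j j'. j + j' = ?d + 1 \<Longrightarrow> ?d > 0 \<Longrightarrow> di j = di' j'" for up di lo up' di' lo'
    by (rule eq_matI) (auto simp: tridiagonal_def rev_mat_def intro!: that)
  have "X_mat m' = rev_mat (tridiagonal ?d (\<lambda>j. - a_upper m j) (\<lambda>j. - a_diag m j) (\<lambda>j. - a_lower m j))"
    unfolding X_mat_def d by (rule sym) (simp_all add: u diag)
  also have "\<dots> = - rev_mat (X_mat m)"
    by (rule eq_matI) (auto simp: X_mat_def tridiagonal_def rev_mat_def)
  finally show "X_mat m' = - rev_mat (X_mat m)" .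
  show "Y_mat m' = rev_mat (Y_mat m)"
    unfolding Y_mat_def d by (rule sym) (simp_all add: v diag)
qed

definition exchange_mat :: "nat \<Rightarrow> 'a::semiring_1 mat" where
  "exchange_mat d = Matrix.mat d d (\<lambda>(i, j). if i + j + 1 = d then 1 else 0)"

text \<open>The exchange matrix is its own inverse; multiplication by it from the left reverses rows
  and from the right reverses columns.\<close>

lemma similar_rev_mat:
  fixes A :: "'a::comm_ring_1 mat"
  assumes "A \<in> carrier_mat d d"
  shows "similar_mat_wit A (rev_mat A) (exchange_mat d) (exchange_mat d)"
proof -
  have left: "exchange_mat d * B = Matrix.mat d d (\<lambda>(i, j). B $$ (d - Suc i, j))"
    if "B \<in> carrier_mat d d" for B :: "'a mat"
  proof (rule eq_matI)
    fix i j assume "i < dim_row (Matrix.mat d d (\<lambda>(i, j). B $$ (d - Suc i, j)))"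
      "j < dim_col (Matrix.mat d d (\<lambda>(i, j). B $$ (d - Suc i, j)))"
    then have ij: "i < d" "j < d" by auto
    then have "(exchange_mat d * B) $$ (i, j) = (\<Sum>k = 0..<d. (if i + k + 1 = d then 1 else 0) * B $$ (k, j))"
      using that by (simp add: exchange_mat_def scalar_prod_def)
    also have "\<dots> = (\<Sum>k = 0..<d. if k = d - Suc i then B $$ (k, j) else 0)"
      using ij by (intro sum.cong) auto
    also have "\<dots> = B $$ (d - Suc i, j)" using ij by (simp add: sum.delta)
    finally show "(exchange_mat d * B) $$ (i, j) = Matrix.mat d d (\<lambda>(i, j). B $$ (d - Suc i, j)) $$ (i, j)"
      using ij by simp
  qed (use that in \<open>auto simp: exchange_mat_def\<close>)
  have right: "B * exchange_mat d = Matrix.mat d d (\<lambda>(i, j). B $$ (i, d - Suc j))"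
    if "B \<in> carrier_mat d d" for B :: "'a mat"
  proof (rule eq_matI)
    fix i j assume "i < dim_row (Matrix.mat d d (\<lambda>(i, j). B $$ (i, d - Suc j)))"
      "j < dim_col (Matrix.mat d d (\<lambda>(i, j). B $$ (i, d - Suc j)))"
    then have ij: "i < d" "j < d" by auto
    then have "(B * exchange_mat d) $$ (i, j) = (\<Sum>k = 0..<d. B $$ (i, k) * (if k + j + 1 = d then 1 else 0))"
      using that by (simp add: exchange_mat_def scalar_prod_def)
    also have "\<dots> = (\<Sum>k = 0..<d. if k = d - Suc j then B $$ (i, k) else 0)"
      using ij by (intro sum.cong) auto
    also have "\<dots> = B $$ (i, d - Suc j)" using ij by (simp add: sum.delta)
    finally show "(B * exchange_mat d) $$ (i, j) = Matrix.mat d d (\<lambda>(i, j). B $$ (i, d - Suc j)) $$ (i, j)"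
      using ij by simp
  qed (use that in \<open>auto simp: exchange_mat_def\<close>)
  have J: "exchange_mat d \<in> carrier_mat d d" by (simp add: exchange_mat_def)
  have JJ: "exchange_mat d * exchange_mat d = (1\<^sub>m d :: 'a mat)"
    unfolding left[OF J] by (rule eq_matI) (auto simp: exchange_mat_def)
  have R: "rev_mat A \<in> carrier_mat d d" using assms by (auto simp: rev_mat_def)
  have JR: "exchange_mat d * rev_mat A \<in> carrier_mat d d" using J R by (rule mult_carrier_mat)
  have "A = exchange_mat d * rev_mat A * exchange_mat d"
    unfolding right[OF JR] unfolding left[OF R]
    by (rule eq_matI) (use assms in \<open>auto simp: rev_mat_def\<close>)
  then show ?thesis
    unfolding similar_mat_wit_def Let_def using assms J R JJ by auto
qed

section \<open>Integrality\<close>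

notation vec_index (infixl "\<^bold>$" 100)

text \<open>The sum of the eigenspaces of \<open>A\<close> for eigenvalues in \<open>S\<close>,
  built by adding one eigenvector at a time to obtain an induction principle without choosing
  bases.\<close>

inductive_set eig_span :: "complex mat \<Rightarrow> nat \<Rightarrow> complex set \<Rightarrow> complex vec set" for A n S where
  zero: "0\<^sub>v n \<in> eig_span A n S"
| add: "v \<in> carrier_vec n \<Longrightarrow> A *\<^sub>v v = z \<cdot>\<^sub>v v \<Longrightarrow> z \<in> S \<Longrightarrow> u \<in> eig_span A n S \<Longrightarrow> v + u \<in> eig_span A n S"

lemma eig_span_carrier: "u \<in> eig_span A n S \<Longrightarrow> u \<in> carrier_vec n"
  by (induction rule: eig_span.induct) auto

lemma eig_span_eigenvector:
  "v \<in> carrier_vec n \<Longrightarrow> A *\<^sub>v v = z \<cdot>\<^sub>v v \<Longrightarrow> z \<in> S \<Longrightarrow> v \<in> eig_span A n S"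
  using eig_span.add[OF _ _ _ eig_span.zero, of v n A z S] by simp

lemma eig_span_add:
  assumes "u \<in> eig_span A n S" "w \<in> eig_span A n S"
  shows "u + w \<in> eig_span A n S"
  using assms(1)
proof (induction rule: eig_span.induct)
  case zero
  then show ?case using assms(2) eig_span_carrier[OF assms(2)] by simp
next
  case (add v z u)
  then have "v + u + w = v + (u + w)"
    using eig_span_carrier[OF assms(2)] eig_span_carrier[OF add(4)] by (intro assoc_add_vec)
  then show ?case using add by (metis eig_span.add)
qed

lemma eig_span_smult:
  assumes "A \<in> carrier_mat n n" "u \<in> eig_span A n S"
  shows "c \<cdot>\<^sub>v u \<in> eig_span A n S"
  using assms(2)
proof (induction rule: eig_span.induct)
  case zero
  have "c \<cdot>\<^sub>v 0\<^sub>v n = (0\<^sub>v n :: complex vec)" by auto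
  then show ?case by (simp add: eig_span.zero)
next
  case (add v z u)
  have "c \<cdot>\<^sub>v (v + u) = c \<cdot>\<^sub>v v + c \<cdot>\<^sub>v u"
    using add(1) eig_span_carrier[OF add(4)] by (rule smult_add_distrib_vec)
  moreover have "A *\<^sub>v (c \<cdot>\<^sub>v v) = z \<cdot>\<^sub>v (c \<cdot>\<^sub>v v)"
    using add(1,2) assms(1) by (simp add: mult_mat_vec smult_smult_assoc mult.commute)
  ultimately show ?case using add by (metis eig_span.add smult_carrier_vec)
qed

text \<open>Reduces a membership claim to single eigenvectors. Additivity of \<open>f\<close>
  suffices because scalars are absorbed into the eigenvectors.\<close>

lemma eig_span_image:
  assumes "u \<in> eig_span A n S"
    and "\<And>v w. v \<in> carrier_vec n \<Longrightarrow> w \<in> carrier_vec n \<Longrightarrow> f (v + w) = f v + f w" "f (0\<^sub>v n) = 0\<^sub>v m"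
    and "\<And>v z. v \<in> carrier_vec n \<Longrightarrow> A *\<^sub>v v = z \<cdot>\<^sub>v v \<Longrightarrow> z \<in> S \<Longrightarrow> f v \<in> eig_span B m S'"
  shows "f u \<in> eig_span B m S'"
  using assms(1)
proof (induction rule: eig_span.induct)
  case zero
  then show ?case by (simp add: assms(3) eig_span.zero)
next
  case (add v z u)
  then show ?case using assms(2)[OF add(1) eig_span_carrier[OF add(4)]] assms(4) eig_span_add by simp
qed

text \<open>Applying the product of the \<open>A - z\<close> over the eigenvalues \<open>z\<close> involved in a sum of eigenvectors kills it.\<close>

lemma eigenvalue_in_eig_span:
  assumes A: "A \<in> carrier_mat n n" and u: "u \<in> eig_span A n S" "u \<noteq> 0\<^sub>v n" "A *\<^sub>v u = \<mu> \<cdot>\<^sub>v u"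
  shows "\<mu> \<in> S"
proof (rule ccontr)
  assume mu: "\<mu> \<notin> S"
  define L where "L = (\<lambda>z v. A *\<^sub>v v - z \<cdot>\<^sub>v v)"
  define K where "K = foldr L"
  have L_carrier: "L z v \<in> carrier_vec n" if "v \<in> carrier_vec n" for z v
    using that A by (simp add: L_def)
  have K_carrier: "K zs v \<in> carrier_vec n" if "v \<in> carrier_vec n" for zs v
    by (induction zs) (simp_all add: K_def that L_carrier)
  have L_add: "L z (v + w) = L z v + L z w" if "v \<in> carrier_vec n" "w \<in> carrier_vec n" for z v w
    unfolding L_def mult_add_distrib_mat_vec[OF A that] smult_add_distrib_vec[OF that]
    using that A by (intro eq_vecI) auto
  have K_add: "K zs (v + w) = K zs v + K zs w" if "v \<in> carrier_vec n" "w \<in> carrier_vec n" for zs v w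
    by (induction zs) (simp_all add: K_def that L_add K_carrier[unfolded K_def])
  have L_eig: "L z (c \<cdot>\<^sub>v v) = ((y - z) * c) \<cdot>\<^sub>v v" if "v \<in> carrier_vec n" "A *\<^sub>v v = y \<cdot>\<^sub>v v" for z y c v
  proof -
    have "A *\<^sub>v (c \<cdot>\<^sub>v v) = c \<cdot>\<^sub>v (y \<cdot>\<^sub>v v)" using that A by (simp add: mult_mat_vec)
    then show ?thesis unfolding L_def using that(1) by (intro eq_vecI) (auto simp: algebra_simps)
  qed
  have K_eig: "K zs v = (\<Prod>z\<leftarrow>zs. y - z) \<cdot>\<^sub>v v" if "v \<in> carrier_vec n" "A *\<^sub>v v = y \<cdot>\<^sub>v v" for zs y v
    by (induction zs) (simp_all add: K_def L_eig[OF that])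
  have "\<exists>zs. set zs \<subseteq> S \<and> K zs u = 0\<^sub>v n"
    using u(1)
  proof (induction rule: eig_span.induct)
    case zero
    show ?case by (rule exI[of _ "[]"]) (simp add: K_def)
  next
    case (add v z u)
    then obtain zs where zs: "set zs \<subseteq> S" "K zs u = 0\<^sub>v n" by blast
    \<comment> \<open>The old factors already kill \<open>u\<close>, and the new factor for
      \<open>z\<close> kills the multiple of \<open>v\<close> that remains.\<close>
    have "K (z # zs) (v + u) = L z (K zs v + K zs u)"
      using K_add[OF add(1) eig_span_carrier[OF add(4)]] by (simp add: K_def)
    also have "\<dots> = L z ((\<Prod>y\<leftarrow>zs. z - y) \<cdot>\<^sub>v v)"
      using zs(2) K_carrier[OF add(1)] K_eig[OF add(1,2)] add(1) by simp
    also have "\<dots> = 0\<^sub>v n"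
      unfolding L_eig[OF add(1,2)] using add(1) by (intro eq_vecI) auto
    finally show ?case using zs(1) add(3) by (intro exI[of _ "z # zs"]) simp
  qed
  then obtain zs where zs: "set zs \<subseteq> S" "K zs u = 0\<^sub>v n" by blast
  have uc: "u \<in> carrier_vec n" using eig_span_carrier[OF u(1)] .
  \<comment> \<open>No factor vanishes, since \<open>\<mu>\<close> lies outside \<open>S\<close> and
    all of \<open>zs\<close> inside.\<close>
  have nz: "(\<Prod>z\<leftarrow>zs. \<mu> - z) \<noteq> 0"
    using zs(1) mu by (induction zs) auto
  have 0: "(\<Prod>z\<leftarrow>zs. \<mu> - z) \<cdot>\<^sub>v u = 0\<^sub>v n" using K_eig[OF uc u(3)] zs(2) by simp
  have "u = 0\<^sub>v n"
  proof (rule eq_vecI)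
    fix i assume "i < dim_vec (0\<^sub>v n :: complex vec)"
    then have i: "i < n" by simp
    then have "((\<Prod>z\<leftarrow>zs. \<mu> - z) \<cdot>\<^sub>v u) \<^bold>$ i = 0" unfolding 0 by simp
    then show "u \<^bold>$ i = 0\<^sub>v n \<^bold>$ i" using i uc nz by simp
  qed (use uc in simp)
  with u(2) show False by simp
qed

section \<open>Eigenvectors in tensor products\<close>

definition kron_vec :: "complex vec \<Rightarrow> complex vec \<Rightarrow> complex vec" where
  "kron_vec v w = Matrix.vec (dim_vec v * dim_vec w)
     (\<lambda>i. v \<^bold>$ (i div dim_vec w) * w \<^bold>$ (i mod dim_vec w))"

lemma kron_vec_carrier: "v \<in> carrier_vec n \<Longrightarrow> w \<in> carrier_vec m \<Longrightarrow> kron_vec v w \<in> carrier_vec (n * m)"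
  by (auto simp: kron_vec_def)

lemma div_mod_less: "i < n * m \<Longrightarrow> i div m < n \<and> i mod m < m" for i n m :: nat
  by (cases "m = 0") (auto simp: less_mult_imp_div_less)

lemma mult_add_less:
  fixes i j n m :: nat
  assumes "i < n" "j < m"
  shows "i * m + j < n * m"
proof -
  have "i * m + j < Suc i * m" using assms(2) by simp
  also have "\<dots> \<le> n * m" using assms(1) by (intro mult_le_mono1) simp
  finally show ?thesis .
qed

lemma sum_div_mod:
  fixes F :: "nat \<Rightarrow> nat \<Rightarrow> complex"
  shows "(\<Sum>k = 0..<n * m. F (k div m) (k mod m)) = (\<Sum>i = 0..<n. \<Sum>j = 0..<m. F i j)"
proof -
  have "(\<Sum>k = 0..<n * m. F (k div m) (k mod m)) = (\<Sum>(i, j)\<in>{0..<n} \<times> {0..<m}. F i j)"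
    by (rule sum.reindex_bij_witness[of _ "\<lambda>(i, j). i * m + j" "\<lambda>k. (k div m, k mod m)"])
       (use div_mod_less mult_add_less in auto)
  then show ?thesis by (simp add: sum.cartesian_product)
qed

lemma kronecker_kron_vec:
  assumes "A \<in> carrier_mat n n" "B \<in> carrier_mat m m" "v \<in> carrier_vec n" "w \<in> carrier_vec m"
  shows "kronecker A B *\<^sub>v kron_vec v w = kron_vec (A *\<^sub>v v) (B *\<^sub>v w)"
proof (rule eq_vecI)
  fix i assume "i < dim_vec (kron_vec (A *\<^sub>v v) (B *\<^sub>v w))"
  then have i: "i < n * m" using assms by (simp add: kron_vec_def)
  note im = div_mod_less[OF i]
  have "(kronecker A B *\<^sub>v kron_vec v w) \<^bold>$ i =
    (\<Sum>k = 0..<n * m. (A $$ (i div m, k div m) * v \<^bold>$ (k div m)) * (B $$ (i mod m, k mod m) * w \<^bold>$ (k mod m)))"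
    using assms i by (auto simp: kronecker_def kron_vec_def scalar_prod_def mult_ac intro!: sum.cong)
  also have "\<dots> = (\<Sum>k = 0..<n. \<Sum>l = 0..<m. (A $$ (i div m, k) * v \<^bold>$ k) * (B $$ (i mod m, l) * w \<^bold>$ l))"
    by (rule sum_div_mod)
  also have "\<dots> = (\<Sum>k = 0..<n. A $$ (i div m, k) * v \<^bold>$ k) * (\<Sum>l = 0..<m. B $$ (i mod m, l) * w \<^bold>$ l)"
    by (simp add: sum_product)
  also have "\<dots> = kron_vec (A *\<^sub>v v) (B *\<^sub>v w) \<^bold>$ i"
    using assms i im by (simp add: kron_vec_def scalar_prod_def)
  finally show "(kronecker A B *\<^sub>v kron_vec v w) \<^bold>$ i = kron_vec (A *\<^sub>v v) (B *\<^sub>v w) \<^bold>$ i" .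
qed (use assms in \<open>auto simp: kronecker_def kron_vec_def\<close>)

lemma kronecker_carrier:
  "A \<in> carrier_mat n n \<Longrightarrow> B \<in> carrier_mat m m \<Longrightarrow> kronecker A B \<in> carrier_mat (n * m) (n * m)"
  by (auto simp: kronecker_def)

text \<open>Eigenvalues add on tensor products of eigenvectors. Two applications of
  \<open>eig_span_image\<close> extend this to all pure tensors, and every vector is a sum of pure
  tensors.\<close>

lemma eig_span_tensor:
  assumes A: "A \<in> carrier_mat n n" "B \<in> carrier_mat m m"
    and S: "\<And>x y. x \<in> S \<Longrightarrow> y \<in> S' \<Longrightarrow> x + y \<in> S''"
    and full: "eig_span A n S = carrier_vec n" "eig_span B m S' = carrier_vec m"
  shows "eig_span (kronecker A (1\<^sub>m m) + kronecker (1\<^sub>m n) B) (n * m) S'' = carrier_vec (n * m)"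
proof -
  let ?C = "kronecker A (1\<^sub>m m) + kronecker (1\<^sub>m n) B"
  have C: "?C \<in> carrier_mat (n * m) (n * m)" using A by (intro add_carrier_mat kronecker_carrier one_carrier_mat)
  have prod: "kron_vec v w \<in> eig_span ?C (n * m) S''"
    if v: "v \<in> carrier_vec n" and w: "w \<in> carrier_vec m" for v w
  proof (rule eig_span_image[where f = "\<lambda>v. kron_vec v w" and A = A and n = n and S = S])
    show "v \<in> eig_span A n S" using v full by simp
    show "kron_vec (x + y) w = kron_vec x w + kron_vec y w" if "x \<in> carrier_vec n" "y \<in> carrier_vec n" for x y
      using that w div_mod_less by (intro eq_vecI) (auto simp: kron_vec_def algebra_simps)
    show "kron_vec (0\<^sub>v n) w = 0\<^sub>v (n * m)"
      using w div_mod_less by (intro eq_vecI) (auto simp: kron_vec_def)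
    fix x z assume x: "x \<in> carrier_vec n" "A *\<^sub>v x = z \<cdot>\<^sub>v x" "z \<in> S"
    show "kron_vec x w \<in> eig_span ?C (n * m) S''"
    proof (rule eig_span_image[where f = "\<lambda>w. kron_vec x w" and A = B and n = m and S = S'])
      show "w \<in> eig_span B m S'" using w full by simp
      show "kron_vec x (a + b) = kron_vec x a + kron_vec x b" if "a \<in> carrier_vec m" "b \<in> carrier_vec m" for a b
        using that x div_mod_less by (intro eq_vecI) (auto simp: kron_vec_def algebra_simps)
      show "kron_vec x (0\<^sub>v m) = 0\<^sub>v (n * m)"
        using x div_mod_less by (intro eq_vecI) (auto simp: kron_vec_def)
      fix y z' assume y: "y \<in> carrier_vec m" "B *\<^sub>v y = z' \<cdot>\<^sub>v y" "z' \<in> S'"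
      have "?C *\<^sub>v kron_vec x y = kronecker A (1\<^sub>m m) *\<^sub>v kron_vec x y + kronecker (1\<^sub>m n) B *\<^sub>v kron_vec x y"
        by (rule add_mult_distrib_mat_vec[OF kronecker_carrier[OF A(1) one_carrier_mat]
              kronecker_carrier[OF one_carrier_mat A(2)] kron_vec_carrier[OF x(1) y(1)]])
      also have "\<dots> = kron_vec (z \<cdot>\<^sub>v x) y + kron_vec x (z' \<cdot>\<^sub>v y)"
        by (simp only: kronecker_kron_vec[OF A(1) one_carrier_mat x(1) y(1)] x(2) y(2)
            kronecker_kron_vec[OF one_carrier_mat A(2) x(1) y(1)]
            one_mult_mat_vec[OF x(1)] one_mult_mat_vec[OF y(1)])
      also have "\<dots> = (z + z') \<cdot>\<^sub>v kron_vec x y"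
        using x y div_mod_less by (intro eq_vecI) (auto simp: kron_vec_def algebra_simps)
      finally show "kron_vec x y \<in> eig_span ?C (n * m) S''"
        using S x(3) y(3) kron_vec_carrier[OF x(1) y(1)] by (intro eig_span_eigenvector)
    qed
  qed
  have "u \<in> eig_span ?C (n * m) S''" if u: "u \<in> carrier_vec (n * m)" for u
  proof -
    \<comment> \<open>Truncation of \<open>u\<close> to second index below \<open>k\<close>. Each
      step adds one slice tensored with a unit vector, and at \<open>k = m\<close> the truncation is
      \<open>u\<close> itself.\<close>
    have "Matrix.vec (n * m) (\<lambda>i. if i mod m < k then u \<^bold>$ i else 0) \<in> eig_span ?C (n * m) S''" for k
    proof (induction k)
      case 0
      have "Matrix.vec (n * m) (\<lambda>i. if i mod m < 0 then u \<^bold>$ i else 0) = 0\<^sub>v (n * m)"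
        by (intro eq_vecI) auto
      then show ?case by (simp only: eig_span.zero)
    next
      case (Suc k)
      show ?case
      proof (cases "k < m")
        case True
        have "Matrix.vec (n * m) (\<lambda>i. if i mod m < Suc k then u \<^bold>$ i else 0) =
          Matrix.vec (n * m) (\<lambda>i. if i mod m < k then u \<^bold>$ i else 0) +
          kron_vec (Matrix.vec n (\<lambda>i. u \<^bold>$ (i * m + k))) (unit_vec m k)"
        proof (rule eq_vecI)
          fix i assume "i < dim_vec (Matrix.vec (n * m) (\<lambda>i. if i mod m < k then u \<^bold>$ i else 0) +
            kron_vec (Matrix.vec n (\<lambda>i. u \<^bold>$ (i * m + k))) (unit_vec m k))"
          then have "i < n * m" by (simp add: kron_vec_def)
          moreover have "i div m * m + k = i" if "i mod m = k"
            using that div_mult_mod_eq[of i m] by metis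
          ultimately show "Matrix.vec (n * m) (\<lambda>i. if i mod m < Suc k then u \<^bold>$ i else 0) \<^bold>$ i =
            (Matrix.vec (n * m) (\<lambda>i. if i mod m < k then u \<^bold>$ i else 0) +
            kron_vec (Matrix.vec n (\<lambda>i. u \<^bold>$ (i * m + k))) (unit_vec m k)) \<^bold>$ i"
            using div_mod_less[of i n m] True by (auto simp: kron_vec_def unit_vec_def less_Suc_eq)
        qed (simp add: kron_vec_def)
        then show ?thesis using Suc prod by (auto intro!: eig_span_add)
      next
        case False
        have "Matrix.vec (n * m) (\<lambda>i. if i mod m < Suc k then u \<^bold>$ i else 0) =
          Matrix.vec (n * m) (\<lambda>i. if i mod m < k then u \<^bold>$ i else 0)"
          using False div_mod_less[of _ n m] by (intro eq_vecI) (auto, meson le_less_trans not_less)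
        then show ?thesis using Suc by simp
      qed
    qed
    from this[of m] show ?thesis
    proof -
      have "Matrix.vec (n * m) (\<lambda>i. if i mod m < m then u \<^bold>$ i else 0) = u"
        using u div_mod_less[of _ n m] by (intro eq_vecI) auto
      with \<open>Matrix.vec (n * m) (\<lambda>i. if i mod m < m then u \<^bold>$ i else 0) \<in> eig_span ?C (n * m) S''\<close>
      show ?thesis by simp
    qed
  qed
  then show ?thesis using eig_span_carrier by blast
qed

section \<open>Weights of irreducible representations of \<open>su_3\<close>\<close>

lemma subspace_vecI:
  fixes U :: "complex vec set"
  assumes "U \<subseteq> carrier_vec n" "0\<^sub>v n \<in> U" "\<And>u v. u \<in> U \<Longrightarrow> v \<in> U \<Longrightarrow> u + v \<in> U"
    "\<And>c u. u \<in> U \<Longrightarrow> c \<cdot>\<^sub>v u \<in> U"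
  shows "subspace class_ring U (module_vec TYPE(complex) n)"
proof -
  interpret V: vectorspace class_ring "module_vec TYPE(complex) n" by (rule vec_vs)
  show ?thesis
    unfolding subspace_def submodule_def
    using assms V.vectorspace_axioms V.module_axioms by (auto simp: module_vec_simps)
qed

text \<open>The fraction is the eigenvalue of \<open>E 1 1\<close> on a highest weight vector of
  \<open>[a, b]\<close>. Weights differ by roots, on which \<open>E 1 1\<close> takes integer
  values.\<close>

definition weight_coset :: "real \<Rightarrow> real \<Rightarrow> complex set" where
  "weight_coset a b = {of_real ((2 * (a - 1) + (b - 1)) / 3) + of_int k | k. True}"

lemma su3_irrep_highest_weight:
  assumes "su3_irrep a b N E"
  obtains v where "v \<in> carrier_vec N" "v \<noteq> 0\<^sub>v N"
    "E 1 1 *\<^sub>v v = of_real ((2 * (a - 1) + (b - 1)) / 3) \<cdot>\<^sub>v v"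
proof -
  have rep: "su3_rep N E" using assms by (simp add: su3_irrep_def su3_irreducible_def)
  obtain v where v: "v \<in> carrier_vec N" "v \<noteq> 0\<^sub>v N"
    and h: "(E 1 1 - E 2 2) *\<^sub>v v = complex_of_real (a - 1) \<cdot>\<^sub>v v"
      "(E 2 2 - E 3 3) *\<^sub>v v = complex_of_real (b - 1) \<cdot>\<^sub>v v"
    using assms by (auto simp: su3_irrep_def)
  have c: "E 1 1 \<in> carrier_mat N N" "E 2 2 \<in> carrier_mat N N" "E 3 3 \<in> carrier_mat N N"
    and tr: "E 1 1 + E 2 2 + E 3 3 = 0\<^sub>m N N"
    using rep by (auto simp: su3_rep_def)
  have "E 1 1 *\<^sub>v v = of_real ((2 * (a - 1) + (b - 1)) / 3) \<cdot>\<^sub>v v"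
  proof (rule eq_vecI)
    fix i assume "i < dim_vec (complex_of_real ((2 * (a - 1) + (b - 1)) / 3) \<cdot>\<^sub>v v)"
    then have i: "i < N" using v by simp
    have 1: "(E 1 1 *\<^sub>v v) \<^bold>$ i - (E 2 2 *\<^sub>v v) \<^bold>$ i = complex_of_real (a - 1) * v \<^bold>$ i"
      using arg_cong[OF h(1), of "\<lambda>u. u \<^bold>$ i"] i v c by (simp add: minus_mult_distrib_mat_vec)
    have 2: "(E 2 2 *\<^sub>v v) \<^bold>$ i - (E 3 3 *\<^sub>v v) \<^bold>$ i = complex_of_real (b - 1) * v \<^bold>$ i"
      using arg_cong[OF h(2), of "\<lambda>u. u \<^bold>$ i"] i v c by (simp add: minus_mult_distrib_mat_vec)
    have "0\<^sub>m N N *\<^sub>v v = (E 1 1 + E 2 2) *\<^sub>v v + E 3 3 *\<^sub>v v"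
      unfolding tr[symmetric] using c v by (intro add_mult_distrib_mat_vec) auto
    also have "(E 1 1 + E 2 2) *\<^sub>v v = E 1 1 *\<^sub>v v + E 2 2 *\<^sub>v v"
      using c v by (intro add_mult_distrib_mat_vec) auto
    finally have "0\<^sub>m N N *\<^sub>v v = E 1 1 *\<^sub>v v + E 2 2 *\<^sub>v v + E 3 3 *\<^sub>v v" .
    moreover have "0\<^sub>m N N *\<^sub>v v = 0\<^sub>v N" using v by (intro eq_vecI) auto
    ultimately have "E 1 1 *\<^sub>v v + E 2 2 *\<^sub>v v + E 3 3 *\<^sub>v v = 0\<^sub>v N" by simp
    from arg_cong[OF this, of "\<lambda>u. u \<^bold>$ i"]
    have 3: "(E 1 1 *\<^sub>v v) \<^bold>$ i + (E 2 2 *\<^sub>v v) \<^bold>$ i + (E 3 3 *\<^sub>v v) \<^bold>$ i = 0"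
      using i v c by simp
    define x y z where "x = (E 1 1 *\<^sub>v v) \<^bold>$ i" and "y = (E 2 2 *\<^sub>v v) \<^bold>$ i" and "z = (E 3 3 *\<^sub>v v) \<^bold>$ i"
    \<comment> \<open>The trace condition makes \<open>E 1 1\<close> a combination of the two Cartan
      elements whose eigenvalues are the Dynkin labels.\<close>
    have "3 * x = 2 * (x - y) + (y - z) + (x + y + z)" by (simp add: algebra_simps)
    also have "\<dots> = (2 * complex_of_real (a - 1) + complex_of_real (b - 1)) * v \<^bold>$ i"
      unfolding 1[folded x_def y_def] 2[folded y_def z_def] 3[folded x_def y_def z_def]
      by (simp add: algebra_simps)
    finally have "x = complex_of_real ((2 * (a - 1) + (b - 1)) / 3) * v \<^bold>$ i"
      by (simp add: field_simps)
    then show "(E 1 1 *\<^sub>v v) \<^bold>$ i = (complex_of_real ((2 * (a - 1) + (b - 1)) / 3) \<cdot>\<^sub>v v) \<^bold>$ i"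
      using i v by (simp add: x_def)
  qed (use v c in auto)
  with v show ?thesis using that by blast
qed

text \<open>The bracket of \<open>E 1 1\<close> with \<open>E i j\<close> is -1, 0 or 1 times
  \<open>E i j\<close>, so each generator shifts eigenvalues by an integer. The eigenvectors in the
  coset thus span an invariant subspace, which contains a highest weight vector and is everything by
  irreducibility.\<close>

lemma su3_irrep_weights:
  assumes "su3_irrep a b N E"
  shows "eig_span (E 1 1) N (weight_coset a b) = carrier_vec N"
proof -
  let ?S = "weight_coset a b" and ?U = "eig_span (E 1 1) N (weight_coset a b)"
  have irr: "su3_irreducible N E" and rep: "su3_rep N E"
    using assms by (auto simp: su3_irrep_def su3_irreducible_def)
  have c: "E i j \<in> carrier_mat N N" if "i \<in> {1..3}" "j \<in> {1..3}" for i j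
    using rep that by (auto simp: su3_rep_def)
  have c11: "E 1 1 \<in> carrier_mat N N" by (rule c) auto
  obtain v where v: "v \<in> carrier_vec N" "v \<noteq> 0\<^sub>v N"
    "E 1 1 *\<^sub>v v = of_real ((2 * (a - 1) + (b - 1)) / 3) \<cdot>\<^sub>v v"
    using su3_irrep_highest_weight[OF assms] by blast
  have "of_real ((2 * (a - 1) + (b - 1)) / 3) \<in> ?S"
    unfolding weight_coset_def by (intro CollectI exI[of _ 0]) simp
  with v have vU: "v \<in> ?U" by (intro eig_span_eigenvector)
  have inv: "E i j *\<^sub>v u \<in> ?U" if ij: "i \<in> {1..3}" "j \<in> {1..3}" and u: "u \<in> ?U" for i j u
  proof (rule eig_span_image[OF u])
    show "E i j *\<^sub>v (x + y) = E i j *\<^sub>v x + E i j *\<^sub>v y" if "x \<in> carrier_vec N" "y \<in> carrier_vec N" for x y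
      using c[OF ij] that by (rule mult_add_distrib_mat_vec)
    show "E i j *\<^sub>v 0\<^sub>v N = 0\<^sub>v N" using c[OF ij] by auto
    fix x z assume x: "x \<in> carrier_vec N" "E 1 1 *\<^sub>v x = z \<cdot>\<^sub>v x" "z \<in> ?S"
    have comm: "E 1 1 * E i j - E i j * E 1 1 =
        (if 1 = i then E 1 j else 0\<^sub>m N N) - (if j = 1 then E i 1 else 0\<^sub>m N N)"
      using rep ij unfolding su3_rep_def by auto
    have "\<exists>s::int. E 1 1 * E i j - E i j * E 1 1 = of_int s \<cdot>\<^sub>m E i j"
    proof -
      consider "i = 1" "j = 1" | "i = 1" "j \<noteq> 1" | "i \<noteq> 1" "j = 1" | "i \<noteq> 1" "j \<noteq> 1" by blast
      then show ?thesis
      proof cases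
        case 1
        then show ?thesis using comm c11 by (intro exI[of _ 0]) (auto intro!: eq_matI)
      next
        case 2
        then show ?thesis using comm c[OF ij] by (intro exI[of _ 1]) (auto intro!: eq_matI)
      next
        case 3
        then show ?thesis using comm c[OF ij] by (intro exI[of _ "-1"]) (auto intro!: eq_matI)
      next
        case 4
        then show ?thesis using comm c[OF ij] by (intro exI[of _ 0]) (auto intro!: eq_matI)
      qed
    qed
    then obtain s :: int where s: "E 1 1 * E i j - E i j * E 1 1 = of_int s \<cdot>\<^sub>m E i j" ..
    have "(E 1 1 * E i j - E i j * E 1 1) *\<^sub>v x = (E 1 1 * E i j) *\<^sub>v x - (E i j * E 1 1) *\<^sub>v x"
      using c11 c[OF ij] x(1) by (intro minus_mult_distrib_mat_vec) auto
    also have "\<dots> = E 1 1 *\<^sub>v (E i j *\<^sub>v x) - z \<cdot>\<^sub>v (E i j *\<^sub>v x)"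
      using c11 c[OF ij] x by (simp add: assoc_mult_mat_vec mult_mat_vec)
    finally have eq: "E 1 1 *\<^sub>v (E i j *\<^sub>v x) - z \<cdot>\<^sub>v (E i j *\<^sub>v x) = (of_int s \<cdot>\<^sub>m E i j) *\<^sub>v x"
      using s by simp
    have "E 1 1 *\<^sub>v (E i j *\<^sub>v x) = (z + of_int s) \<cdot>\<^sub>v (E i j *\<^sub>v x)"
    proof (rule eq_vecI)
      fix k assume "k < dim_vec ((z + of_int s) \<cdot>\<^sub>v (E i j *\<^sub>v x))"
      then have k: "k < N" using c[OF ij] by simp
      have "(E 1 1 *\<^sub>v (E i j *\<^sub>v x)) \<^bold>$ k - z * (E i j *\<^sub>v x) \<^bold>$ k = of_int s * (E i j *\<^sub>v x) \<^bold>$ k"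
        using arg_cong[OF eq, of "\<lambda>u. u \<^bold>$ k"] k c11 c[OF ij] x(1) by (simp add: scalar_prod_def sum_distrib_left mult.assoc)
      then show "(E 1 1 *\<^sub>v (E i j *\<^sub>v x)) \<^bold>$ k = ((z + of_int s) \<cdot>\<^sub>v (E i j *\<^sub>v x)) \<^bold>$ k"
        using k c[OF ij] by (simp add: algebra_simps)
    qed (use c11 c[OF ij] in auto)
    moreover have "z + of_int s \<in> ?S"
    proof -
      from x(3) obtain k where "z = of_real ((2 * (a - 1) + (b - 1)) / 3) + of_int k"
        by (auto simp: weight_coset_def)
      then show ?thesis unfolding weight_coset_def by (intro CollectI exI[of _ "k + s"]) simp
    qed
    ultimately show "E i j *\<^sub>v x \<in> ?U"
      using c[OF ij] x(1) by (intro eig_span_eigenvector) auto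
  qed
  have "subspace class_ring ?U (module_vec TYPE(complex) N)"
    using eig_span_carrier eig_span.zero eig_span_add eig_span_smult[OF c11]
    by (intro subspace_vecI) auto
  then have "?U = {0\<^sub>v N} \<or> ?U = carrier_vec N"
    using irr inv unfolding su3_irreducible_def by blast
  with vU v(2) show ?thesis by auto
qed

text \<open>Schur's argument: the kernel is an invariant subspace, and it is proper because
  \<open>T\<close> is not zero.\<close>

lemma nonzero_intertwiner_kernel:
  assumes irr: "su3_irreducible N E" and T: "T \<in> intertwiners N E K F" "T \<noteq> 0\<^sub>m K N"
    and F: "\<And>i j. i \<in> {1..3} \<Longrightarrow> j \<in> {1..3} \<Longrightarrow> F i j \<in> carrier_mat K K"
    and v: "v \<in> carrier_vec N" "v \<noteq> 0\<^sub>v N"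
  shows "T *\<^sub>v v \<noteq> 0\<^sub>v K"
proof -
  have c: "E i j \<in> carrier_mat N N" if "i \<in> {1..3}" "j \<in> {1..3}" for i j
    using irr that by (auto simp: su3_irreducible_def su3_rep_def)
  have Tc: "T \<in> carrier_mat K N" and comm: "\<And>i j. i \<in> {1..3} \<Longrightarrow> j \<in> {1..3} \<Longrightarrow> T * E i j = F i j * T"
    using T(1) by (auto simp: intertwiners_def)
  let ?U = "{u \<in> carrier_vec N. T *\<^sub>v u = 0\<^sub>v K}"
  have "subspace class_ring ?U (module_vec TYPE(complex) N)"
    using Tc by (intro subspace_vecI) (auto simp: mult_add_distrib_mat_vec mult_mat_vec)
  moreover have "E i j *\<^sub>v u \<in> ?U" if "i \<in> {1..3}" "j \<in> {1..3}" "u \<in> ?U" for i j u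
  proof -
    have "T *\<^sub>v (E i j *\<^sub>v u) = (T * E i j) *\<^sub>v u"
      using Tc c[OF that(1,2)] that(3) by (intro assoc_mult_mat_vec[symmetric]) auto
    also have "\<dots> = F i j *\<^sub>v (T *\<^sub>v u)"
      unfolding comm[OF that(1,2)] using Tc F[OF that(1,2)] that(3) by (intro assoc_mult_mat_vec) auto
    also have "\<dots> = 0\<^sub>v K" using that(3) F[OF that(1,2)] by auto
    finally show ?thesis using c[OF that(1,2)] that(3) by auto
  qed
  ultimately have U: "?U = {0\<^sub>v N} \<or> ?U = carrier_vec N"
    using irr unfolding su3_irreducible_def by blast
  have "?U \<noteq> carrier_vec N"
  proof
    assume all: "?U = carrier_vec N"
    have "T = 0\<^sub>m K N"
    proof (rule eq_matI)
      fix i j assume "i < dim_row (0\<^sub>m K N :: complex mat)" "j < dim_col (0\<^sub>m K N :: complex mat)"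
      then have ij: "i < K" "j < N" by auto
      have "unit_vec N j \<in> ?U" unfolding all using ij by simp
      then have "(T *\<^sub>v unit_vec N j) \<^bold>$ i = 0" using ij by simp
      then show "T $$ (i, j) = 0\<^sub>m K N $$ (i, j)" using ij Tc by simp
    qed (use Tc in auto)
    with T(2) show False by simp
  qed
  with U v show ?thesis by blast
qed

lemma ex_nonzero_intertwiner:
  assumes "vectorspace.dim class_ring ((module_mat TYPE(complex) K N) \<lparr>carrier := intertwiners N E K F\<rparr>) > 0"
    and F: "\<And>i j. i \<in> {1..3} \<Longrightarrow> j \<in> {1..3} \<Longrightarrow> F i j \<in> carrier_mat K K"
    and E: "\<And>i j. i \<in> {1..3} \<Longrightarrow> j \<in> {1..3} \<Longrightarrow> E i j \<in> carrier_mat N N"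
  shows "\<exists>T\<in>intertwiners N E K F. T \<noteq> 0\<^sub>m K N"
proof (rule ccontr)
  assume "\<not> ?thesis"
  moreover have "0\<^sub>m K N \<in> intertwiners N E K F"
    using left_mult_zero_mat[OF E] right_mult_zero_mat[OF F] by (auto simp: intertwiners_def)
  ultimately have eq: "intertwiners N E K F = {0\<^sub>m K N}" by blast
  interpret V: vectorspace class_ring "module_mat TYPE(complex) K N" by (rule matrix_vs)
  have "subspace class_ring {0\<^sub>m K N} (module_mat TYPE(complex) K N)"
    unfolding subspace_def submodule_def
    using V.vectorspace_axioms V.module_axioms by (auto simp: module_mat_simps)
  then interpret W: vectorspace class_ring "(module_mat TYPE(complex) K N)\<lparr>carrier := {0\<^sub>m K N}\<rparr>"
    by (rule V.subspace_is_vs)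
  \<comment> \<open>The empty set generates the zero space, so its dimension is 0, contrary to the
    assumption.\<close>
  have "W.gen_set {}" using W.span_empty by (simp add: module_mat_simps)
  then have "W.dim = 0"
    unfolding W.dim_def by (intro Least_eq_0 exI[of _ "{}"]) simp
  then show False using assms(1) eq by simp
qed

text \<open>A nonzero intertwiner maps a highest weight vector to an eigenvector of
  \<open>E 1 1\<close> in the tensor product. Its eigenvalue must lie in the sum of the two weight
  cosets, and this is the integrality of \<open>par_n m\<close>.\<close>

lemma tensor_multiplicity_integral:
  assumes "is_tensor_multiplicity m d" "d > 0"
  shows "par_n m \<in> \<int>"
proof -
  obtain N E N' E' N'' E'' where r: "su3_irrep (m M1) (m M2) N E" "su3_irrep (m M1') (m M2') N' E'"
      "su3_irrep (m M1'') (m M2'') N'' E''"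
    and d: "d = vectorspace.dim class_ring
              ((module_mat TYPE(complex) (N * N') N'')
                \<lparr>carrier := intertwiners N'' E'' (N * N') (tensor_rep N E N' E')\<rparr>)"
    using assms(1) unfolding is_tensor_multiplicity_def by blast
  let ?F = "tensor_rep N E N' E'"
  have c: "E i j \<in> carrier_mat N N" "E' i j \<in> carrier_mat N' N'" "E'' i j \<in> carrier_mat N'' N''"
    if "i \<in> {1..3}" "j \<in> {1..3}" for i j
    using r that by (auto simp: su3_irrep_def su3_irreducible_def su3_rep_def)
  have F: "?F i j \<in> carrier_mat (N * N') (N * N')" if "i \<in> {1..3}" "j \<in> {1..3}" for i j
    using c[OF that] unfolding tensor_rep_def by (intro add_carrier_mat kronecker_carrier one_carrier_mat)
  obtain T where T: "T \<in> intertwiners N'' E'' (N * N') ?F" "T \<noteq> 0\<^sub>m (N * N') N''"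
    using ex_nonzero_intertwiner[OF assms(2)[unfolded d] F c(3)] by blast
  obtain v where v: "v \<in> carrier_vec N''" "v \<noteq> 0\<^sub>v N''"
    "E'' 1 1 *\<^sub>v v = of_real ((2 * (m M1'' - 1) + (m M2'' - 1)) / 3) \<cdot>\<^sub>v v" (is "_ = ?\<mu> \<cdot>\<^sub>v v")
    using su3_irrep_highest_weight[OF r(3)] by blast
  have one: "(1::nat) \<in> {1..3}" by simp
  have Tc: "T \<in> carrier_mat (N * N') N''" and comm: "T * E'' 1 1 = ?F 1 1 * T"
    using T(1) one by (auto simp: intertwiners_def)
  let ?w = "T *\<^sub>v v"
  have w: "?w \<in> carrier_vec (N * N')" using Tc v by simp
  have "?w \<noteq> 0\<^sub>v (N * N')"
    using nonzero_intertwiner_kernel[OF _ T F v(1,2)] r(3) by (simp add: su3_irrep_def)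
  moreover have "?F 1 1 *\<^sub>v ?w = ?\<mu> \<cdot>\<^sub>v ?w"
  proof -
    have "?F 1 1 *\<^sub>v ?w = (T * E'' 1 1) *\<^sub>v v"
      unfolding comm using F[OF one one] Tc v by (intro assoc_mult_mat_vec[symmetric]) auto
    also have "\<dots> = T *\<^sub>v (?\<mu> \<cdot>\<^sub>v v)"
      using Tc c(3)[OF one one] v by (simp add: assoc_mult_mat_vec)
    also have "\<dots> = ?\<mu> \<cdot>\<^sub>v ?w" using Tc v by (simp add: mult_mat_vec)
    finally show ?thesis .
  qed
  moreover define S where "S = {x + y | x y. x \<in> weight_coset (m M1) (m M2) \<and> y \<in> weight_coset (m M1') (m M2')}"
  have "?w \<in> eig_span (?F 1 1) (N * N') S"
    unfolding tensor_rep_def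
    using eig_span_tensor[OF c(1,2)[OF one one] _ su3_irrep_weights[OF r(1)] su3_irrep_weights[OF r(2)], of S] w
    by (auto simp: S_def)
  ultimately have "?\<mu> \<in> S"
    using eigenvalue_in_eig_span[OF F[OF one one]] by blast
  then obtain k l where "?\<mu> = of_real ((2 * (m M1 - 1) + (m M2 - 1)) / 3) + of_int k +
      (of_real ((2 * (m M1' - 1) + (m M2' - 1)) / 3) + of_int l)"
    by (auto simp: S_def weight_coset_def)
  then have "complex_of_real ((2 * (m M1'' - 1) + (m M2'' - 1)) / 3) =
    complex_of_real ((2 * (m M1 - 1) + (m M2 - 1)) / 3 + of_int k + ((2 * (m M1' - 1) + (m M2' - 1)) / 3 + of_int l))"
    by simp
  then have "(2 * (m M1'' - 1) + (m M2'' - 1)) / 3 =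
    (2 * (m M1 - 1) + (m M2 - 1)) / 3 + of_int k + ((2 * (m M1' - 1) + (m M2' - 1)) / 3 + of_int l)"
    by (simp only: of_real_eq_iff)
  then have "par_n m = of_int (1 - k - l)" by (simp add: par_n_def field_simps)
  then show ?thesis by (metis Ints_of_int)
qed

section \<open>The action on the matrices\<close>

text \<open>The two cases in the definition of \<open>xi\<close> correspond to the sign of
  \<open>f = par_l - par_n\<close>; the term \<open>min f 0\<close> merges them.\<close>

lemma tops_mk_params:
  "tops (mk_params a b c d e f) =
     {#a + b + c + min f 0, a + b + c + min f 0 + d, a + b + c + min f 0 + d + e#}"
  by (auto simp: tops_def interval_1_3 xi_def Let_def min_def add_mset_commute algebra_simps)

lemma bots_mk_params: "bots (mk_params a b c d e f) = {#0, a, a + b#}"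
  by (auto simp: bots_def interval_4_6 xi_def Let_def add_mset_commute algebra_simps)

context e6
begin

lemma param_action_simple_refl_matrices:
  assumes "i \<in> {1, 2, 4, 5, 6}" and "m' = param_action \<alpha> (ml_gen i) m"
  shows "xi_a m' - xi_b m' = xi_a m - xi_b m \<and> X_mat m' = X_mat m \<and> Y_mat m' = Y_mat m"
proof -
  obtain a b c d e f where m: "m = mk_params a b c d e f" by (rule mk_params_exhaust)
  \<comment> \<open>Only the reflection of node 1 shifts the two multisets. Nodes 2, 4 and 5 permute
    elements within one of them, and node 6 leaves the sum of \<open>c\<close> and
    \<open>min f 0\<close> unchanged.\<close>
  define s where "s = (if i = 1 then - a else 0)"
  have "tops m' = image_mset (\<lambda>x. s + x) (tops m)"
    using assms by (auto simp: m s_def param_action_ml_gen tops_mk_params add_mset_commute min_def algebra_simps)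
  moreover have "bots m' = image_mset (\<lambda>x. s + x) (bots m)"
    using assms by (auto simp: m s_def param_action_ml_gen bots_mk_params add_mset_commute)
  moreover have "\<bar>par_l m' - par_n m'\<bar> = \<bar>par_l m - par_n m\<bar>"
    using assms by (auto simp: m param_action_ml_gen)
  ultimately show ?thesis using shift_invariant by blast
qed

lemma param_action_dual_flip_matrices:
  assumes "m' = param_action \<alpha> (ml_gen 0) m"
  shows "xi_a m' - xi_b m' = xi_a m - xi_b m \<and>
    (xi_a m - xi_b m \<in> \<int> \<longrightarrow>
      X_mat m' = - rev_mat (X_mat m) \<and> Y_mat m' = rev_mat (Y_mat m))"
proof -
  obtain a b c d e f where m: "m = mk_params a b c d e f" by (rule mk_params_exhaust)
  \<comment> \<open>The centre of the reflection is \<open>t / 2\<close>. The number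
    \<open>t\<close> is unchanged when \<open>a, e\<close> and \<open>b, d\<close> are
    exchanged.\<close>
  define t where "t = a + b + c + min f 0 + d + e"
  have "tops m' = image_mset (\<lambda>x. t - x) (bots m)"
    unfolding assms by (simp add: m t_def param_action_ml_gen tops_mk_params bots_mk_params add_mset_commute algebra_simps)
  moreover have "bots m' = image_mset (\<lambda>x. t - x) (tops m)"
    unfolding assms by (simp add: m t_def param_action_ml_gen tops_mk_params bots_mk_params add_mset_commute algebra_simps)
  moreover have "\<bar>par_l m' - par_n m'\<bar> = \<bar>par_l m - par_n m\<bar>"
    unfolding assms by (simp add: m param_action_ml_gen)
  ultimately show ?thesis using reflect_reverses by blast
qed

end

text \<open>Here and in \<open>reverses_matrices\<close>, preservation of \<open>xi_a - xi_b\<close>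
  is included so that the integrality condition is available again when transformations are
  composed.\<close>

definition fixes_matrices :: "(params \<Rightarrow> params) \<Rightarrow> bool" where
  "fixes_matrices T \<longleftrightarrow> (\<forall>m. xi_a (T m) - xi_b (T m) = xi_a m - xi_b m \<and>
     (xi_a m - xi_b m \<in> \<int> \<longrightarrow> X_mat (T m) = X_mat m \<and> Y_mat (T m) = Y_mat m))"

definition reverses_matrices :: "(params \<Rightarrow> params) \<Rightarrow> bool" where
  "reverses_matrices T \<longleftrightarrow> (\<forall>m. xi_a (T m) - xi_b (T m) = xi_a m - xi_b m \<and>
     (xi_a m - xi_b m \<in> \<int> \<longrightarrow> X_mat (T m) = - rev_mat (X_mat m) \<and> Y_mat (T m) = rev_mat (Y_mat m)))"

lemma rev_mat_uminus: "rev_mat (- A) = - rev_mat A"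
  by (rule eq_matI) (auto simp: rev_mat_def)

lemma rev_mat_rev_mat: "rev_mat (rev_mat A) = A"
  by (rule eq_matI) (auto simp: rev_mat_def)

lemma matrices_comp:
  "fixes_matrices S \<Longrightarrow> fixes_matrices T \<Longrightarrow> fixes_matrices (S \<circ> T)"
  "fixes_matrices S \<Longrightarrow> reverses_matrices T \<Longrightarrow> reverses_matrices (S \<circ> T)"
  "reverses_matrices S \<Longrightarrow> fixes_matrices T \<Longrightarrow> reverses_matrices (S \<circ> T)"
  "reverses_matrices S \<Longrightarrow> reverses_matrices T \<Longrightarrow> fixes_matrices (S \<circ> T)"
  by (simp_all add: fixes_matrices_def reverses_matrices_def rev_mat_uminus rev_mat_rev_mat)

section \<open>The sign of a group element and the conjugation of the matrices\<close>

context e6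
begin

lemma weyl_group_comp: "v \<in> weyl_group \<alpha> \<Longrightarrow> w \<in> weyl_group \<alpha> \<Longrightarrow> v \<circ> w \<in> weyl_group \<alpha>"
  unfolding weyl_group_def using bij_simple_refl by (intro generate_BijGroup_comp) auto

lemma linear_weyl_group: "w \<in> weyl_group \<alpha> \<Longrightarrow> linear w"
  using weyl_group_iff linear_word_refl by auto

lemma neg_weyl_comp:
  shows "v \<in> weyl_group \<alpha> \<Longrightarrow> w \<in> neg_weyl \<alpha> \<Longrightarrow> v \<circ> w \<in> neg_weyl \<alpha>"
    and "v \<in> neg_weyl \<alpha> \<Longrightarrow> w \<in> weyl_group \<alpha> \<Longrightarrow> v \<circ> w \<in> neg_weyl \<alpha>"
    and "v \<in> neg_weyl \<alpha> \<Longrightarrow> w \<in> neg_weyl \<alpha> \<Longrightarrow> v \<circ> w \<in> weyl_group \<alpha>"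
proof -
  have *: "(v \<circ> (\<lambda>x. - w x)) = (\<lambda>x. - (v \<circ> w) x)" if "linear v" for v w :: "real^6 \<Rightarrow> real^6"
    using linear_neg[OF that] by (simp add: fun_eq_iff)
  show "v \<in> weyl_group \<alpha> \<Longrightarrow> w \<in> neg_weyl \<alpha> \<Longrightarrow> v \<circ> w \<in> neg_weyl \<alpha>"
    unfolding neg_weyl_def using *[OF linear_weyl_group] weyl_group_comp by fastforce
  show "v \<circ> w \<in> neg_weyl \<alpha>" if v: "v \<in> neg_weyl \<alpha>" and w: "w \<in> weyl_group \<alpha>"
  proof -
    from v obtain v' where v': "v' \<in> weyl_group \<alpha>" "v = (\<lambda>x. - v' x)" by (auto simp: neg_weyl_def)
    then have "v \<circ> w = (\<lambda>x. - (v' \<circ> w) x)" by (simp add: fun_eq_iff)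
    with weyl_group_comp[OF v'(1) w] show ?thesis unfolding neg_weyl_def by blast
  qed
  show "v \<circ> w \<in> weyl_group \<alpha>" if v: "v \<in> neg_weyl \<alpha>" and w: "w \<in> neg_weyl \<alpha>"
  proof -
    from v w obtain v' w' where "v' \<in> weyl_group \<alpha>" "w' \<in> weyl_group \<alpha>"
      "v = (\<lambda>x. - v' x)" "w = (\<lambda>x. - w' x)" by (auto simp: neg_weyl_def)
    moreover from this have "v \<circ> w = v' \<circ> w'"
      using linear_neg[OF linear_weyl_group[of v']] by (simp add: fun_eq_iff)
    ultimately show ?thesis using weyl_group_comp by simp
  qed
qed

text \<open>The sign in the group and the reversal of the matrices multiply in the same way:
  reflections are of the first kind, \<open>-w_0\<close> of the second, and two reversals
  cancel.\<close>

lemma param_action_matrices: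
  assumes "g \<in> missing_label_subgroup \<alpha>"
  shows "g \<in> weyl_group \<alpha> \<and> fixes_matrices (param_action \<alpha> g) \<or>
    g \<in> neg_weyl \<alpha> \<and> reverses_matrices (param_action \<alpha> g)"
  using assms
proof (induction rule: missing_label_subgroup_induct)
  case id
  have "id \<in> weyl_group \<alpha>" by (simp add: weyl_group_def generate_BijGroup_id)
  moreover have "fixes_matrices id" by (simp add: fixes_matrices_def)
  ultimately show ?case unfolding param_action_id by blast
next
  case (gen i)
  show ?case
  proof (cases "i = 0")
    case True
    have "longest_element \<alpha> \<in> weyl_group \<alpha>"
      unfolding longest_element_eq weyl_group_iff using longest_word_nodes by blast
    then have "ml_gen i \<in> neg_weyl \<alpha>" unfolding neg_weyl_def True ml_gen_def by auto
    then show ?thesis using param_action_dual_flip_matrices unfolding True reverses_matrices_def by blast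
  next
    case False
    then have i: "i \<in> {1, 2, 4, 5, 6}" using gen by blast
    then have "simple_refl \<alpha> i \<in> weyl_group \<alpha>"
      unfolding weyl_group_def by (intro generate.incl imageI) auto
    then have "ml_gen i \<in> weyl_group \<alpha>" using False by (simp add: ml_gen_def)
    then show ?thesis using param_action_simple_refl_matrices[OF i] unfolding fixes_matrices_def by blast
  qed
next
  case (comp g h)
  show ?case
    unfolding param_action_comp[OF linear_missing_label_subgroup[OF comp(1)]]
    using comp(3,4) weyl_group_comp[of g h] neg_weyl_comp[of g h] matrices_comp by blast
qed

text \<open>The sum of \<open>par_l\<close> and \<open>par_n\<close> is an integral combination of
  the parameters, so integrality of one gives that of the other and of all
  \<open>xi\<close>.\<close>

lemma integral_xi:
  assumes "\<forall>k. m k \<in> \<nat> \<and> m k > 0" "par_n m \<in> \<int>"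
  shows "xi_a m - xi_b m \<in> \<int>"
proof -
  have m: "m k \<in> \<int>" for k using assms(1) Nats_subset_Ints by blast
  have "par_l m = m M1 + m M2 + m M1' + m M2' - m M1'' - m M2'' - par_n m"
    by (simp add: par_l_def par_n_def field_simps)
  then have l: "par_l m \<in> \<int>" using m assms(2) by simp
  have xi: "xi m i \<in> \<int>" if "i \<in> {1..3} \<union> {4..6}" for i
    using that m l assms(2) unfolding interval_1_3 interval_4_6 by (auto simp: xi_def Let_def)
  have "xi_a m \<in> xi m ` {1..3}" unfolding xi_a_def by (intro Min_in) auto
  moreover have "xi_b m \<in> xi m ` {4..6}" unfolding xi_b_def by (intro Max_in) auto
  ultimately show ?thesis using xi by (auto intro!: Ints_diff)
qed

text \<open>The same pair \<open>P\<close>, \<open>Q\<close> serves both matrices: identities in the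
  Weyl group, exchange matrices in its negative. Disjointness of the two sets decides the sign in
  the first case.\<close>

lemma similar_matrices:
  assumes "g \<in> missing_label_subgroup \<alpha>" "xi_a m - xi_b m \<in> \<int>"
  shows "\<exists>P Q.
    similar_mat_wit (X_mat m) ((if g \<in> neg_weyl \<alpha> then -1 else 1) \<cdot>\<^sub>m X_mat (param_action \<alpha> g m)) P Q \<and>
    similar_mat_wit (Y_mat m) (Y_mat (param_action \<alpha> g m)) P Q"
proof -
  have c: "X_mat m \<in> carrier_mat (mat_size m) (mat_size m)" "Y_mat m \<in> carrier_mat (mat_size m) (mat_size m)"
    by (simp_all add: X_mat_def Y_mat_def tridiagonal_def)
  from param_action_matrices[OF assms(1)] show ?thesis
  proof (elim disjE conjE)
    assume "g \<in> weyl_group \<alpha>" "fixes_matrices (param_action \<alpha> g)"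
    then have "g \<notin> neg_weyl \<alpha>" "X_mat (param_action \<alpha> g m) = X_mat m" "Y_mat (param_action \<alpha> g m) = Y_mat m"
      using weyl_group_neg_weyl_disjoint assms(2) by (auto simp: fixes_matrices_def reverses_matrices_def)
    moreover have "1 \<cdot>\<^sub>m X_mat m = X_mat m" by (rule eq_matI) auto
    ultimately show ?thesis
      using similar_mat_wit_refl[OF c(1)] similar_mat_wit_refl[OF c(2)] by auto
  next
    assume "g \<in> neg_weyl \<alpha>" "reverses_matrices (param_action \<alpha> g)"
    then have "g \<in> neg_weyl \<alpha>" "X_mat (param_action \<alpha> g m) = - rev_mat (X_mat m)"
      "Y_mat (param_action \<alpha> g m) = rev_mat (Y_mat m)"
      using assms(2) by (auto simp: fixes_matrices_def reverses_matrices_def)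
    moreover have "-1 \<cdot>\<^sub>m - rev_mat (X_mat m) = rev_mat (X_mat m)" by (rule eq_matI) auto
    ultimately show ?thesis
      using similar_rev_mat[OF c(1)] similar_rev_mat[OF c(2)] by auto
  qed
qed

end

theorem corollary3p6:
  fixes \<alpha> :: "nat \<Rightarrow> real^6"
  assumes "e6_simple_roots \<alpha>"
  shows
    "subgroup (missing_label_subgroup \<alpha>) ((BijGroup UNIV)\<lparr>carrier := pm_weyl_group \<alpha>\<rparr>) \<and>
     bij_betw (param_action \<alpha>) (missing_label_subgroup \<alpha>) missing_label_symmetries \<and>
     (\<forall>g\<in>missing_label_subgroup \<alpha>. \<forall>h\<in>missing_label_subgroup \<alpha>.
        param_action \<alpha> (g \<circ> h) = param_action \<alpha> h \<circ> param_action \<alpha> g) \<and>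
     (\<forall>g\<in>missing_label_subgroup \<alpha>. \<forall>(m :: params) d.
        (\<forall>k. m k \<in> \<nat> \<and> m k > 0) \<longrightarrow> is_tensor_multiplicity m d \<longrightarrow> d > 0 \<longrightarrow>
        (\<exists>P Q.
           similar_mat_wit (X_mat m)
             ((if g \<in> neg_weyl \<alpha> then -1 else 1) \<cdot>\<^sub>m X_mat (param_action \<alpha> g m)) P Q \<and>
           similar_mat_wit (Y_mat m) (Y_mat (param_action \<alpha> g m)) P Q))"
proof -
  interpret e6 \<alpha> by unfold_locales (rule assms)
  show ?thesis
    using missing_label_subgroup_subgroup bij_betw_param_action
      param_action_comp[OF linear_missing_label_subgroup] 
      similar_matrices integral_xi tensor_multiplicity_integral by blast
qed

end
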